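(* Let $1<p\leq 2\leq q<\infty$. Suppose that $m$ is an $A$-Fourier multiplier with $A$-symbol $\sigma_m$ on $\mathbb{R}^n$. Then $$\|m\|_{L^p(\mathbb{R}^n)\to L^q(\mathbb{R}^n)}\lesssim\sup_{s>0}\, s\left(\sum_{\substack{j\in\mathbb{N}\\ |\sigma_m(j)|>s}}\|u_j\|_{L^\infty(\mathbb{R}^n)}^2\right)^{\frac1p-\frac1q}.$$
   Context: Fix integers $n,k,l\geq 1$ and let $A=A_{k,l}=(-\Delta)^l+|x|^{2k}+1$ on $\mathbb{R}^n$ (the anharmonic oscillator), where $\Delta$ is the Laplacian and $|\cdot|$ the Euclidean norm. $A$ has a unique self-adjoint extension on $L^2(\mathbb{R}^n)$ (again denoted $A$), with purely discrete spectrum contained in $(0,\infty)$. Let $(u_j)_{j\in\mathbb{N}}$ be an orthonormal basis of $L^2(\mathbb{R}^n)$ consisting of eigenfunctions of $A$, with corresponding eigenvalues $(\lambda_j)_{j\in\mathbb{N}}$ in increasing order, repeated according to multiplicity. The $A$-Fourier transform of $f$ is $\mathcal{F}_Af(j)=\int_{\mathbb{R}^n}f(x)\overline{u_j(x)}\,dx$, $j\in\mathbb{N}$. Let $C_A^\infty(\mathbb{R}^n)=\bigcap_{N\geq 1}\mathrm{Dom}(A^N)$, where $\mathrm{Dom}(A^N)=\{u\in L^2(\mathbb{R}^n):\sum_j\lambda_j^{2N}|\langle u_j,u\rangle_{L^2}|^2<\infty\}$. An $A$-Fourier multiplier with $A$-symbol $\sigma_m:\mathbb{N}\to\mathbb{C}$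 is a linear operator $m$ satisfying $\mathcal{F}_A(mf)(j)=\sigma_m(j)\,\mathcal{F}_Af(j)$ for all $j\in\mathbb{N}$ and $f\in C_A^\infty(\mathbb{R}^n)$. The norm $\|m\|_{L^p\to L^q}$ is the smallest $C$ with $\|mf\|_{L^q}\leq C\|f\|_{L^p}$ for $f\in C_A^\infty(\mathbb{R}^n)\cap L^p(\mathbb{R}^n)$. The notation $X\lesssim Y$ means $X\leq CY$ with a constant $C>0$ independent of $m$. *)

theory Defs
  imports "HOL-Probability.Essential_Supremum"
begin

section \<open>Lebesgue spaces\<close>

text \<open>Powers of extended nonnegative reals. The base \<open>0\<close> always gives \<open>0\<close>, also for the exponent
  \<open>0\<close> (as for \<^const>\<open>powr\<close> on the reals), and \<open>\<infinity>\<close> to the exponent \<open>0\<close> is \<open>1\<close>. The exponent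
  \<open>1/p - 1/q\<close> vanishes for \<open>p = q = 2\<close>; with these conventions
  \<open>sup s * (\<Sum>|\<sigma> j| > s. c j) ^ 0\<close> is then \<open>sup |\<sigma> j|\<close> whenever all \<open>c j\<close> are positive. Only
  exponents \<open>a \<ge> 0\<close> are used.\<close>

definition ennpow :: "ennreal \<Rightarrow> real \<Rightarrow> ennreal" where
  "ennpow x a =
     (if x = \<infinity> then (if a = 0 then 1 else \<infinity>) else ennreal (enn2real x powr a))"

definition Lp_norm :: "real \<Rightarrow> ('a::euclidean_space \<Rightarrow> complex) \<Rightarrow> ennreal" where
  "Lp_norm p f = ennpow (\<integral>\<^sup>+ x. ennreal (cmod (f x) powr p) \<partial>lebesgue) (1 / p)"

definition Linf_norm :: "('a::euclidean_space \<Rightarrow> complex) \<Rightarrow> ennreal" where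
  "Linf_norm f = esssup lebesgue (\<lambda>x. ennreal (cmod (f x)))"

text \<open>The elements are functions, not classes of functions modulo equality almost everywhere.\<close>

definition Lp_space :: "real \<Rightarrow> ('a::euclidean_space \<Rightarrow> complex) set" where
  "Lp_space p = {f \<in> borel_measurable lebesgue. Lp_norm p f < \<infinity>}"

definition L2_inner :: "('a::euclidean_space \<Rightarrow> complex) \<Rightarrow> ('a \<Rightarrow> complex) \<Rightarrow> complex" where
  "L2_inner f g = (\<integral> x. f x * cnj (g x) \<partial>lebesgue)"

definition orthonormal_basis :: "(nat \<Rightarrow> 'a::euclidean_space \<Rightarrow> complex) \<Rightarrow> bool" where
  "orthonormal_basis u \<longleftrightarrow>
     (\<forall>j. u j \<in> Lp_space 2) \<and>
     (\<forall>i j. L2_inner (u i) (u j) = (if i = j then 1 else 0)) \<and>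
     (\<forall>f \<in> Lp_space 2.
        (\<lambda>N. Lp_norm 2 (\<lambda>x. f x - (\<Sum>j<N. L2_inner f (u j) * u j x))) \<longlonglongrightarrow> 0)"

section \<open>Unbounded operators on \<open>L\<^sup>2\<close>\<close>

text \<open>An unbounded operator is represented by its graph, a set of pairs \<open>(f, T f)\<close>.\<close>

type_synonym 'a L2_operator = "(('a \<Rightarrow> complex) \<times> ('a \<Rightarrow> complex)) set"

definition adjoint_op :: "'a::euclidean_space L2_operator \<Rightarrow> 'a L2_operator" where
  "adjoint_op T =
     {(g, h). g \<in> Lp_space 2 \<and> h \<in> Lp_space 2 \<and>
        (\<forall>(f, Tf) \<in> T. L2_inner Tf g = L2_inner f h)}"

definition densely_defined :: "'a::euclidean_space L2_operator \<Rightarrow> bool" where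
  "densely_defined T \<longleftrightarrow>
     (\<forall>f \<in> Lp_space 2. \<forall>e::real > 0. \<exists>g \<in> Domain T. Lp_norm 2 (\<lambda>x. f x - g x) < ennreal e)"

text \<open>The equation \<open>T = T*\<close> makes the graph a subspace of \<open>L\<^sup>2 \<times> L\<^sup>2\<close> that is closed under equality
  almost everywhere; by density of the domain it is then single-valued modulo null sets.\<close>

definition self_adjoint :: "'a::euclidean_space L2_operator \<Rightarrow> bool" where
  "self_adjoint T \<longleftrightarrow> densely_defined T \<and> T = adjoint_op T"

section \<open>The anharmonic oscillator\<close>

definition partial_deriv :: "'n::finite \<Rightarrow> (real ^ 'n \<Rightarrow> complex) \<Rightarrow> real ^ 'n \<Rightarrow> complex" where
  "partial_deriv i f x = vector_derivative (\<lambda>t. f (x + t *\<^sub>R axis i 1)) (at 0)"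

text \<open>If all iterated partial derivatives are differentiable, then they are also continuous, so this
  is \<open>C\<^sup>\<infinity>\<close>.\<close>

definition test_functions :: "(real ^ 'n::finite \<Rightarrow> complex) set" where
  "test_functions =
     {f. (\<forall>is. foldr partial_deriv is f differentiable_on UNIV) \<and> compact (closure {x. f x \<noteq> 0})}"

definition laplacian :: "(real ^ 'n::finite \<Rightarrow> complex) \<Rightarrow> real ^ 'n \<Rightarrow> complex" where
  "laplacian f x = (\<Sum>i\<in>UNIV. partial_deriv i (partial_deriv i f) x)"

definition anharmonic_expr ::
    "nat \<Rightarrow> nat \<Rightarrow> (real ^ 'n::finite \<Rightarrow> complex) \<Rightarrow> real ^ 'n \<Rightarrow> complex" where
  "anharmonic_expr k l f x =
     ((\<lambda>g y. - laplacian g y) ^^ l) f x + of_real (norm x ^ (2 * k)) * f x + f x"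

definition anharmonic_op :: "nat \<Rightarrow> nat \<Rightarrow> (real ^ 'n::finite) L2_operator" where
  "anharmonic_op k l = {(f, anharmonic_expr k l f) | f. f \<in> test_functions}"

definition self_adjoint_extension :: 
    "'a::euclidean_space L2_operator \<Rightarrow> 'a L2_operator \<Rightarrow> bool" where
  "self_adjoint_extension T S \<longleftrightarrow> S \<subseteq> T \<and> self_adjoint T"

text \<open>\<open>u\<close> is an orthonormal basis of eigenfunctions of \<open>T\<close> with eigenvalues \<open>ev\<close> in increasing order;
  as \<open>u\<close> is a basis, eigenvalues are automatically repeated according to their multiplicity.\<close>

definition eigenbasis ::
    "'a::euclidean_space L2_operator \<Rightarrow> (nat \<Rightarrow> 'a \<Rightarrow> complex) \<Rightarrow> (nat \<Rightarrow> real) \<Rightarrow> bool" where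
  "eigenbasis T u ev \<longleftrightarrow>
     orthonormal_basis u \<and> (\<forall>j. (u j, \<lambda>x. of_real (ev j) * u j x) \<in> T) \<and> incseq ev"

section \<open>Fourier multipliers\<close>

text \<open>In the following, \<open>u\<close> and \<open>ev\<close> are the eigenfunctions and the eigenvalues of \<open>A\<close>.\<close>

definition A_fourier ::
    "(nat \<Rightarrow> 'a::euclidean_space \<Rightarrow> complex) \<Rightarrow> ('a \<Rightarrow> complex) \<Rightarrow> nat \<Rightarrow> complex" where
  "A_fourier u f j = (\<integral> x. f x * cnj (u j x) \<partial>lebesgue)"

definition dom_power ::
    "(nat \<Rightarrow> 'a::euclidean_space \<Rightarrow> complex) \<Rightarrow> (nat \<Rightarrow> real) \<Rightarrow> nat \<Rightarrow> ('a \<Rightarrow> complex) set" where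
  "dom_power u ev N =
     {f \<in> Lp_space 2. summable (\<lambda>j. ev j ^ (2 * N) * (cmod (L2_inner (u j) f))\<^sup>2)}"

definition CA_infty ::
    "(nat \<Rightarrow> 'a::euclidean_space \<Rightarrow> complex) \<Rightarrow> (nat \<Rightarrow> real) \<Rightarrow> ('a \<Rightarrow> complex) set" where
  "CA_infty u ev = (\<Inter>N\<in>{1..}. dom_power u ev N)"

text \<open>A multiplier takes values in \<open>L\<^sup>2\<close>, where the Fourier coefficients are defined and determine a
  function almost everywhere.\<close>

definition A_multiplier ::
    "(nat \<Rightarrow> 'a::euclidean_space \<Rightarrow> complex) \<Rightarrow> (nat \<Rightarrow> real) \<Rightarrow>
     (('a \<Rightarrow> complex) \<Rightarrow> ('a \<Rightarrow> complex)) \<Rightarrow> (nat \<Rightarrow> complex) \<Rightarrow> bool" where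
  "A_multiplier u ev m \<sigma> \<longleftrightarrow>
     (\<forall>f \<in> CA_infty u ev. m f \<in> Lp_space 2) \<and>
     (\<forall>f \<in> CA_infty u ev. \<forall>g \<in> CA_infty u ev. \<forall>a b.
        AE x in lebesgue. m (\<lambda>y. a * f y + b * g y) x = a * m f x + b * m g x) \<and>
     (\<forall>f \<in> CA_infty u ev. \<forall>j. A_fourier u (m f) j = \<sigma> j * A_fourier u f j)"

definition multiplier_norm ::
    "(nat \<Rightarrow> 'a::euclidean_space \<Rightarrow> complex) \<Rightarrow> (nat \<Rightarrow> real) \<Rightarrow> real \<Rightarrow> real \<Rightarrow>
     (('a \<Rightarrow> complex) \<Rightarrow> ('a \<Rightarrow> complex)) \<Rightarrow> ennreal" where
  "multiplier_norm u ev p q m =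
     Inf {C. \<forall>f \<in> CA_infty u ev \<inter> Lp_space p. Lp_norm q (m f) \<le> C * Lp_norm p f}"

end

theory Submission
  imports Defs
begin

text \<open>Let \<open>c\<^sub>j(f)\<close> be the Fourier coefficients of \<open>f\<close> with respect to the orthonormal basis \<open>u\<close>, and
  let \<open>B\<close> be an upper bound for the supremum in the theorem. Put \<open>a = 1/p - 1/q\<close>, and let \<open>r\<close> be the
  dual exponent of \<open>q\<close>, so that \<open>1 < r \<le> 2\<close>.

  By duality and Parseval's identity it suffices to bound \<open>\<Sum> \<bar>\<sigma>\<^sub>j c\<^sub>j(f) c\<^sub>j(g)\<bar>\<close> by a multiple of
  \<open>B\<close> times the \<open>L\<^sup>p\<close> norm of \<open>f\<close> times the \<open>L\<^sup>r\<close> norm of \<open>g\<close>. Choose \<open>\<theta>\<close>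
  with \<open>\<theta> a = 1/p - 1/2\<close>; then \<open>(1 - \<theta>) a = 1/r - 1/2\<close>. The Cauchy--Schwarz inequality for
  \<open>\<bar>\<sigma>\<bar> = \<bar>\<sigma>\<bar>\<^sup>\<theta> \<bar>\<sigma>\<bar>\<^sup>1\<^sup>-\<^sup>\<theta>\<close> leaves two estimates of the same kind, one for \<open>f\<close> and one for \<open>g\<close>
  (\<open>multiplier_pairing_le\<close>, \<open>Lq_bound_of_pairing_bound\<close>).

  This estimate is a Paley inequality (\<open>weighted_Bessel\<close>): if the weights \<open>\<phi>\<^sub>j \<ge> 0\<close> are such that
  the sum of the squared sup norms of the \<open>u\<^sub>j\<close> with \<open>\<phi>\<^sub>j > s\<close> is at most
  \<open>(B / s) powr (1 / (1/p - 1/2))\<close> for all \<open>s > 0\<close>, then the \<open>\<ell>\<^sup>2\<close> norm of \<open>\<phi>\<^sub>j c\<^sub>j(f)\<close> is at most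
  a constant times \<open>B\<close> times the \<open>L\<^sup>p\<close> norm of \<open>f\<close>. For \<open>p = 2\<close> one asks for \<open>\<phi> \<le> B\<close> instead, and
  the claim is Bessel's inequality. For \<open>1 < p < 2\<close>, group the indices by the dyadic size \<open>2\<^sup>k\<close> of the
  weight, and for each \<open>k\<close> split \<open>f\<close> at a height depending on \<open>k\<close>. Bessel's inequality controls the
  coefficients of the small part, and the trivial estimate of the coefficients by the \<open>L\<^sup>1\<close> norm, together
  with the tail condition, those of the large part (\<open>one_level_bound\<close>). With the right heights the sum
  over \<open>k\<close> is, at every point, a geometric sum dominated by \<open>\<bar>f\<bar>\<^sup>p\<close> (\<open>sum_cut_below_le\<close>,
  \<open>sum_cut_above_le\<close>); for the large parts this needs \<open>p > 1\<close>.\<close>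

section \<open>The inner product of square integrable functions\<close>

lemma ennpow_eq_top_iff: "a > 0 \<Longrightarrow> ennpow x a = \<infinity> \<longleftrightarrow> x = \<infinity>"
  by (auto simp: ennpow_def)

lemma ennpow_le_ennreal_iff:
  assumes "a > 0" "y \<ge> 0"
  shows "ennpow x a \<le> ennreal y \<longleftrightarrow> x \<le> ennreal (y powr (1 / a))"
proof (cases x)
  case (real r)
  have "r powr a \<le> y \<longleftrightarrow> r \<le> y powr (1 / a)"
  proof
    assume "r powr a \<le> y"
    then have "(r powr a) powr (1 / a) \<le> y powr (1 / a)"
      by (intro powr_mono2) (use assms in auto)
    then show "r \<le> y powr (1 / a)"
      using assms real by (simp add: powr_powr)
  next
    assume "r \<le> y powr (1 / a)"
    then have "r powr a \<le> (y powr (1 / a)) powr a"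
      by (intro powr_mono2) (use assms real in auto)
    then show "r powr a \<le> y"
      using assms by (simp add: powr_powr)
  qed
  then show ?thesis
    using real assms by (simp add: ennpow_def)
next
  case top
  then show ?thesis
    using assms by (simp add: ennpow_def top_unique)
qed

text \<open>Bounds on \<open>L\<^sup>p\<close> norms are handled through this equivalence: integrals, unlike their roots, are
  additive.\<close>

lemma Lp_norm_le_iff:
  assumes "p > 0" "N \<ge> 0"
  shows "Lp_norm p f \<le> ennreal N \<longleftrightarrow>
    (\<integral>\<^sup>+x. ennreal (cmod (f x) powr p) \<partial>lebesgue) \<le> ennreal (N powr p)"
  using assms ennpow_le_ennreal_iff[of "1 / p" N] by (simp add: Lp_norm_def)

lemma Lp_space_2_iff:
  "f \<in> Lp_space 2 \<longleftrightarrow>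
     f \<in> borel_measurable lebesgue \<and> (\<integral>\<^sup>+x. ennreal ((cmod (f x))\<^sup>2) \<partial>lebesgue) < \<infinity>"
proof -
  have "ennpow X (1 / 2) < \<infinity> \<longleftrightarrow> X < \<infinity>" for X
    using ennpow_eq_top_iff[of "1/2" X] by (simp add: less_top[symmetric])
  then show ?thesis
    by (simp add: Lp_space_def Lp_norm_def)
qed

lemma measurable_Lp_space: "f \<in> Lp_space p \<Longrightarrow> f \<in> borel_measurable lebesgue"
  by (simp add: Lp_space_def)

lemma Lp_space_2_integrable_iff:
  "f \<in> Lp_space 2 \<longleftrightarrow>
     f \<in> borel_measurable lebesgue \<and> integrable lebesgue (\<lambda>x. (cmod (f x))\<^sup>2)"
  unfolding Lp_space_2_iff
  by (auto simp: integrable_iff_bounded)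

lemma Lp_space_2_dominated:
  assumes "f \<in> Lp_space 2" "g \<in> borel_measurable lebesgue" "\<And>x. cmod (g x) \<le> B * cmod (f x)"
  shows "g \<in> Lp_space 2"
proof -
  have "integrable lebesgue (\<lambda>x. B\<^sup>2 * (cmod (f x))\<^sup>2)"
    using assms(1) by (simp add: Lp_space_2_integrable_iff)
  then have "integrable lebesgue (\<lambda>x. (cmod (g x))\<^sup>2)"
  proof (rule Bochner_Integration.integrable_bound)
    show "(\<lambda>x. (cmod (g x))\<^sup>2) \<in> borel_measurable lebesgue"
      using assms(2) by simp
    show "AE x in lebesgue. norm ((cmod (g x))\<^sup>2) \<le> norm (B\<^sup>2 * (cmod (f x))\<^sup>2)"
      using power_mono[OF assms(3) norm_ge_zero, of _ 2] by (simp add: power_mult_distrib)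
  qed
  then show ?thesis
    using assms(2) by (simp add: Lp_space_2_integrable_iff)
qed

lemma integrable_L2_product:
  assumes "f \<in> Lp_space 2" "g \<in> Lp_space 2"
  shows "integrable lebesgue (\<lambda>x. f x * cnj (g x))"
proof -
  have m [measurable]: "f \<in> borel_measurable lebesgue" "g \<in> borel_measurable lebesgue"
    using assms by (auto intro: measurable_Lp_space)
  have "integrable lebesgue (\<lambda>x. (cmod (f x))\<^sup>2 + (cmod (g x))\<^sup>2)"
    using assms by (simp add: Lp_space_2_integrable_iff)
  then show ?thesis
  proof (rule Bochner_Integration.integrable_bound)
    have "(\<lambda>x. cnj (g x)) \<in> borel_measurable lebesgue"
      by (rule measurable_compose[OF m(2)])
        (intro borel_measurable_continuous_onI continuous_intros)
    then show "(\<lambda>x. f x * cnj (g x)) \<in> borel_measurable lebesgue"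
      by simp
    have "a * b \<le> a\<^sup>2 + b\<^sup>2" if "a \<ge> 0" "b \<ge> 0" for a b :: real
      using sum_squares_bound[of a b] that mult_nonneg_nonneg[OF that] by linarith
    then show "AE x in lebesgue.
        norm (f x * cnj (g x)) \<le> norm ((cmod (f x))\<^sup>2 + (cmod (g x))\<^sup>2)"
      by (simp add: norm_mult)
  qed
qed

lemma Lp_space_2_add:
  assumes "f \<in> Lp_space 2" "g \<in> Lp_space 2"
  shows "(\<lambda>x. f x + g x) \<in> Lp_space 2"
proof -
  have m [measurable]: "f \<in> borel_measurable lebesgue" "g \<in> borel_measurable lebesgue"
    using assms by (auto intro: measurable_Lp_space)
  have "integrable lebesgue (\<lambda>x. 2 * (cmod (f x))\<^sup>2 + 2 * (cmod (g x))\<^sup>2)"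
    using assms by (simp add: Lp_space_2_integrable_iff)
  then have "integrable lebesgue (\<lambda>x. (cmod (f x + g x))\<^sup>2)"
  proof (rule Bochner_Integration.integrable_bound)
    have "(cmod (a + b))\<^sup>2 \<le> 2 * (cmod a)\<^sup>2 + 2 * (cmod b)\<^sup>2" for a b
    proof -
      have "(cmod (a + b))\<^sup>2 \<le> (cmod a + cmod b)\<^sup>2"
        by (intro power_mono norm_triangle_ineq) auto
      also have "\<dots> \<le> 2 * (cmod a)\<^sup>2 + 2 * (cmod b)\<^sup>2"
        using sum_squares_bound[of "cmod a" "cmod b"] by (simp add: power2_sum)
      finally show ?thesis .
    qed
    then show "AE x in lebesgue. norm ((cmod (f x + g x))\<^sup>2)
        \<le> norm (2 * (cmod (f x))\<^sup>2 + 2 * (cmod (g x))\<^sup>2)"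
      by (simp add: abs_of_nonneg)
  qed simp
  then show ?thesis
    by (simp add: Lp_space_2_integrable_iff)
qed

lemma Lp_space_2_scale:
  assumes "f \<in> Lp_space 2" shows "(\<lambda>x. c * f x) \<in> Lp_space 2"
  by (rule Lp_space_2_dominated[OF assms, of _ "cmod c"])
    (use measurable_Lp_space[OF assms] in \<open>auto simp: norm_mult\<close>)

lemma Lp_space_2_diff:
  assumes "f \<in> Lp_space 2" "g \<in> Lp_space 2"
  shows "(\<lambda>x. f x - g x) \<in> Lp_space 2"
  using Lp_space_2_add[OF assms(1) Lp_space_2_scale[OF assms(2), of "-1"]] by simp

lemma zero_in_Lp_space_2: "(\<lambda>x. 0) \<in> Lp_space 2"
  by (simp add: Lp_space_2_integrable_iff)

lemma Lp_space_2_sum: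
  assumes "\<And>j. j \<in> F \<Longrightarrow> g j \<in> Lp_space 2"
  shows "(\<lambda>x. \<Sum>j\<in>F. g j x) \<in> Lp_space 2"
  using assms
  by (induction F rule: infinite_finite_induct) (auto simp: zero_in_Lp_space_2 intro: Lp_space_2_add)

lemma L2_inner_commute: "L2_inner g f = cnj (L2_inner f g)"
  using Bochner_Integration.integral_cnj[of lebesgue "\<lambda>x. f x * cnj (g x)"]
  by (simp add: L2_inner_def mult.commute del: Bochner_Integration.integral_cnj)

lemma L2_inner_add_left:
  assumes "f \<in> Lp_space 2" "g \<in> Lp_space 2" "h \<in> Lp_space 2"
  shows "L2_inner (\<lambda>x. f x + g x) h = L2_inner f h + L2_inner g h"
  unfolding L2_inner_def
  using integrable_L2_product[OF assms(1,3)] integrable_L2_product[OF assms(2,3)]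
  by (simp add: distrib_right)

lemma L2_inner_diff_left:
  assumes "f \<in> Lp_space 2" "g \<in> Lp_space 2" "h \<in> Lp_space 2"
  shows "L2_inner (\<lambda>x. f x - g x) h = L2_inner f h - L2_inner g h"
  unfolding L2_inner_def
  using integrable_L2_product[OF assms(1,3)] integrable_L2_product[OF assms(2,3)]
  by (simp add: left_diff_distrib)

lemma L2_inner_diff_right:
  assumes "f \<in> Lp_space 2" "g \<in> Lp_space 2" "h \<in> Lp_space 2"
  shows "L2_inner h (\<lambda>x. f x - g x) = L2_inner h f - L2_inner h g"
  using L2_inner_diff_left[OF assms] by (simp add: L2_inner_commute[of h])

lemma L2_inner_scale_left: "L2_inner (\<lambda>x. c * f x) h = c * L2_inner f h"
  by (simp add: L2_inner_def mult.assoc)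

lemma L2_inner_scale_right: "L2_inner h (\<lambda>x. c * f x) = cnj c * L2_inner h f"
  using L2_inner_scale_left[of c f h] by (simp add: L2_inner_commute[of h])

lemma L2_inner_sum_left:
  assumes "\<And>j. j \<in> F \<Longrightarrow> g j \<in> Lp_space 2" "h \<in> Lp_space 2"
  shows "L2_inner (\<lambda>x. \<Sum>j\<in>F. g j x) h = (\<Sum>j\<in>F. L2_inner (g j) h)"
proof -
  have "(\<integral>x. (\<Sum>j\<in>F. g j x * cnj (h x)) \<partial>lebesgue)
      = (\<Sum>j\<in>F. \<integral>x. g j x * cnj (h x) \<partial>lebesgue)"
    by (rule Bochner_Integration.integral_sum) (use integrable_L2_product assms in blast)
  then show ?thesis
    by (simp add: L2_inner_def sum_distrib_right)
qed

lemma L2_inner_sum_right: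
  assumes "\<And>j. j \<in> F \<Longrightarrow> g j \<in> Lp_space 2" "h \<in> Lp_space 2"
  shows "L2_inner h (\<lambda>x. \<Sum>j\<in>F. g j x) = (\<Sum>j\<in>F. L2_inner h (g j))"
  unfolding L2_inner_commute[of h]
  by (subst L2_inner_sum_left) (use assms in \<open>auto simp: L2_inner_commute[of h]\<close>)

lemma L2_inner_self: "L2_inner f f = of_real (\<integral>x. (cmod (f x))\<^sup>2 \<partial>lebesgue)"
  unfolding L2_inner_def by (simp add: complex_norm_square[symmetric] flip: of_real_power)

lemma nn_integral_L2_inner_self:
  assumes "f \<in> Lp_space 2"
  shows "(\<integral>\<^sup>+x. ennreal ((cmod (f x))\<^sup>2) \<partial>lebesgue) = ennreal (Re (L2_inner f f))"
  using assms by (simp add: L2_inner_self Lp_space_2_integrable_iff nn_integral_eq_integral)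

lemma L2_inner_self_nonneg: "Re (L2_inner f f) \<ge> 0"
  by (simp add: L2_inner_self)

text \<open>If \<open>g\<close> is not null, the inequality says that \<open>f\<close> minus its projection onto the line spanned by
  \<open>g\<close> has a nonnegative square norm.\<close>

lemma L2_Cauchy_Schwarz:
  assumes f: "f \<in> Lp_space 2" and g: "g \<in> Lp_space 2"
  shows "(cmod (L2_inner f g))\<^sup>2 \<le> Re (L2_inner f f) * Re (L2_inner g g)"
proof (cases "Re (L2_inner g g) = 0")
  case True
  then have "AE x in lebesgue. (cmod (g x))\<^sup>2 = 0"
    using g integral_nonneg_eq_0_iff_AE[of lebesgue "\<lambda>x. (cmod (g x))\<^sup>2"]
    by (simp add: L2_inner_self Lp_space_2_integrable_iff)
  then have "L2_inner f g = 0"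
    unfolding L2_inner_def by (intro integral_eq_zero_AE) auto
  then show ?thesis
    using True by simp
next
  case False
  define G where "G = Re (L2_inner g g)"
  have G: "G > 0" "L2_inner g g = of_real G"
    using False L2_inner_self_nonneg[of g] unfolding G_def
    by (linarith, simp add: L2_inner_self)
  define c where "c = L2_inner f g / of_real G"
  have cg: "(\<lambda>x. c * g x) \<in> Lp_space 2"
    by (rule Lp_space_2_scale[OF g])
  have "L2_inner (\<lambda>x. f x - c * g x) (\<lambda>x. f x - c * g x)
      = L2_inner f f - cnj c * L2_inner f g - c * L2_inner g f + c * cnj c * of_real G"
    using f g cg Lp_space_2_diff[OF f cg]
    by (simp add: L2_inner_diff_left L2_inner_diff_right L2_inner_scale_left
        L2_inner_scale_right G algebra_simps)
  also have "\<dots> = L2_inner f f - c * cnj c * of_real G"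
    using G by (simp add: L2_inner_commute[of g f] c_def field_simps)
  finally have "0 \<le> Re (L2_inner f f) - (cmod c)\<^sup>2 * G"
    using L2_inner_self_nonneg[of "\<lambda>x. f x - c * g x"]
    by (simp add: complex_norm_square[symmetric] flip: of_real_power of_real_mult)
  moreover have "(cmod c)\<^sup>2 * G = (cmod (L2_inner f g))\<^sup>2 / G"
    using G by (simp add: c_def norm_divide power_divide power2_eq_square)
  ultimately show ?thesis
    using G by (simp add: G_def[symmetric] pos_divide_le_eq)
qed

section \<open>Fourier coefficients with respect to an orthonormal basis\<close>

text \<open>The difference of the two sides is the square norm of \<open>f\<close> minus its projection onto the span
  of the \<open>u j\<close> with \<open>j \<in> F\<close>.\<close>

lemma Bessel_inequality:
  assumes u: "orthonormal_basis u" and f: "f \<in> Lp_space 2" and "finite F"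
  shows "(\<Sum>j\<in>F. (cmod (L2_inner f (u j)))\<^sup>2) \<le> Re (L2_inner f f)"
proof -
  have uL: "u j \<in> Lp_space 2" for j
    using u by (simp add: orthonormal_basis_def)
  have uo: "L2_inner (u i) (u j) = (if i = j then 1 else 0)" for i j
    using u by (simp add: orthonormal_basis_def)
  define s where "s = (\<lambda>x. \<Sum>j\<in>F. L2_inner f (u j) * u j x)"
  have cu: "(\<lambda>x. c * u j x) \<in> Lp_space 2" for c j
    by (rule Lp_space_2_scale[OF uL])
  have sL: "s \<in> Lp_space 2"
    unfolding s_def by (intro Lp_space_2_sum cu)
  define E where "E = (\<Sum>j\<in>F. (cmod (L2_inner f (u j)))\<^sup>2)"
  have fs: "L2_inner f s = of_real E"
    unfolding s_def E_def
    by (subst L2_inner_sum_right)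
      (auto simp: cu f L2_inner_scale_right complex_norm_square[symmetric] mult.commute[of "cnj _"])
  have su: "L2_inner s (u j) = L2_inner f (u j)" if "j \<in> F" for j
    unfolding s_def using that \<open>finite F\<close>
    by (subst L2_inner_sum_left) (simp_all add: cu uL L2_inner_scale_left uo if_distrib cong: if_cong)
  have "L2_inner s s = (\<Sum>j\<in>F. cnj (L2_inner f (u j)) * L2_inner s (u j))"
    by (subst (2) s_def, subst L2_inner_sum_right) (simp_all add: cu sL L2_inner_scale_right)
  also have "\<dots> = of_real E"
    by (simp add: su E_def complex_norm_square[symmetric] mult.commute[of "cnj _"])
  finally have ss: "L2_inner s s = of_real E" .
  have "L2_inner (\<lambda>x. f x - s x) (\<lambda>x. f x - s x)
      = L2_inner f f - L2_inner f s - L2_inner s f + L2_inner s s"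
    using f sL Lp_space_2_diff[OF f sL] by (simp add: L2_inner_diff_left L2_inner_diff_right)
  also have "\<dots> = L2_inner f f - of_real E"
    by (simp add: L2_inner_commute[of s f] fs ss)
  finally have "Re (L2_inner (\<lambda>x. f x - s x) (\<lambda>x. f x - s x)) = Re (L2_inner f f) - E"
    by simp
  then show ?thesis
    using L2_inner_self_nonneg[of "\<lambda>x. f x - s x"] by (simp add: E_def)
qed

text \<open>The remainders of the expansion of \<open>f\<close> tend to \<open>0\<close> in \<open>L\<^sup>2\<close>, hence by Cauchy--Schwarz so do
  their inner products with \<open>g\<close>.\<close>

lemma Parseval_identity:
  assumes u: "orthonormal_basis u" and f: "f \<in> Lp_space 2" and g: "g \<in> Lp_space 2"
  shows "(\<lambda>N. \<Sum>j<N. L2_inner f (u j) * cnj (L2_inner g (u j))) \<longlonglongrightarrow> L2_inner f g"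
proof -
  have cu: "(\<lambda>x. c * u j x) \<in> Lp_space 2" for c j
    using u by (intro Lp_space_2_scale) (simp add: orthonormal_basis_def)
  define r where "r N = (\<lambda>x. f x - (\<Sum>j<N. L2_inner f (u j) * u j x))" for N
  have sL: "(\<lambda>x. \<Sum>j<N. L2_inner f (u j) * u j x) \<in> Lp_space 2" for N
    by (intro Lp_space_2_sum cu)
  have rL: "r N \<in> Lp_space 2" for N
    unfolding r_def by (intro Lp_space_2_diff f sL)
  have "(\<lambda>N. Lp_norm 2 (r N)) \<longlonglongrightarrow> 0"
    using u f by (simp add: orthonormal_basis_def r_def)
  moreover have "Lp_norm 2 (r N) = ennreal (sqrt (Re (L2_inner (r N) (r N))))" for N
    using nn_integral_L2_inner_self[OF rL] L2_inner_self_nonneg[of "r N"]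
    by (simp add: Lp_norm_def ennpow_def powr_half_sqrt)
  ultimately have r0: "(\<lambda>N. sqrt (Re (L2_inner (r N) (r N)))) \<longlonglongrightarrow> 0"
    by (simp add: L2_inner_self_nonneg flip: ennreal_0)
  have "(\<lambda>N. L2_inner (r N) g) \<longlonglongrightarrow> 0"
  proof (rule Lim_null_comparison)
    have "cmod (L2_inner (r N) g)
        \<le> sqrt (Re (L2_inner (r N) (r N))) * sqrt (Re (L2_inner g g))" for N
      using real_sqrt_le_mono[OF L2_Cauchy_Schwarz[OF rL g]] by (simp add: real_sqrt_mult)
    then show "\<forall>\<^sub>F N in sequentially. norm (L2_inner (r N) g)
        \<le> sqrt (Re (L2_inner (r N) (r N))) * sqrt (Re (L2_inner g g))"
      by simp
    show "(\<lambda>N. sqrt (Re (L2_inner (r N) (r N))) * sqrt (Re (L2_inner g g))) \<longlonglongrightarrow> 0"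
      by (rule tendsto_mult_left_zero[OF r0])
  qed
  moreover have "L2_inner (r N) g
      = L2_inner f g - (\<Sum>j<N. L2_inner f (u j) * cnj (L2_inner g (u j)))" for N
    unfolding r_def
    by (simp add: L2_inner_diff_left f g sL L2_inner_sum_left cu L2_inner_scale_left
        flip: L2_inner_commute)
  ultimately have "(\<lambda>N. L2_inner f g
      - (\<Sum>j<N. L2_inner f (u j) * cnj (L2_inner g (u j)))) \<longlonglongrightarrow> 0"
    by simp
  from tendsto_diff[OF tendsto_const this, of "L2_inner f g"] show ?thesis
    by simp
qed

text \<open>A null function has no unit norm. Positivity makes the bound of the theorem meaningful for
  \<open>p = q = 2\<close>, where it records only whether a tail of the symbol is empty.\<close>

lemma Linf_norm_orthonormal_pos:
  assumes "orthonormal_basis u"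
  shows "Linf_norm (u j) > 0"
proof (rule ccontr)
  assume "\<not> Linf_norm (u j) > 0"
  then have "Linf_norm (u j) = 0"
    by simp
  then have "AE x in lebesgue. u j x = 0"
    using esssup_AE[of "\<lambda>x. ennreal (cmod (u j x))" lebesgue]
    unfolding Linf_norm_def by (auto elim!: eventually_mono)
  then have "L2_inner (u j) (u j) = 0"
    unfolding L2_inner_def by (intro integral_eq_zero_AE) auto
  then show False
    using assms by (simp add: orthonormal_basis_def)
qed

text \<open>The endpoint \<open>L\<^sup>1\<close> of the interpolation below; Bessel's inequality is the endpoint \<open>L\<^sup>2\<close>.\<close>

lemma Fourier_coefficient_le_L1:
  assumes "u \<in> borel_measurable lebesgue" "f \<in> borel_measurable lebesgue"
  shows "ennreal (cmod (L2_inner f u)) \<le> Linf_norm u * (\<integral>\<^sup>+x. ennreal (cmod (f x)) \<partial>lebesgue)"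
proof -
  note [measurable] = assms
  have "ennreal (cmod (L2_inner f u)) \<le> (\<integral>\<^sup>+x. ennreal (cmod (f x * cnj (u x))) \<partial>lebesgue)"
  proof (cases "integrable lebesgue (\<lambda>x. f x * cnj (u x))")
    case True
    then show ?thesis
      unfolding L2_inner_def by (rule integral_norm_bound_ennreal)
  next
    case False
    then show ?thesis
      by (simp add: L2_inner_def not_integrable_integral_eq)
  qed
  also have "\<dots> \<le> (\<integral>\<^sup>+x. Linf_norm u * ennreal (cmod (f x)) \<partial>lebesgue)"
  proof (rule nn_integral_mono_AE)
    show "AE x in lebesgue. ennreal (cmod (f x * cnj (u x))) \<le> Linf_norm u * ennreal (cmod (f x))"
      using esssup_AE[of "\<lambda>x. ennreal (cmod (u x))" lebesgue] unfolding Linf_norm_def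
      by (rule eventually_mono)
        (simp add: norm_mult ennreal_mult mult.commute[of "ennreal (cmod (f _))"] mult_right_mono)
  qed
  also have "\<dots> = Linf_norm u * (\<integral>\<^sup>+x. ennreal (cmod (f x)) \<partial>lebesgue)"
    by (rule nn_integral_cmult) simp
  finally show ?thesis .
qed

section \<open>Truncated geometric series\<close>

text \<open>A geometric sum is comparable to its largest term, so summing over the dyadic numbers up to \<open>z\<close>
  costs only a constant.\<close>

lemma geometric_sum_below:
  assumes "\<alpha> > 0" "z > 0" "finite K"
  shows "(\<Sum>k | k \<in> K \<and> 2 powr real_of_int k \<le> z. 2 powr (\<alpha> * real_of_int k))
    \<le> z powr \<alpha> / (1 - 2 powr - \<alpha>)"
proof -
  \<comment> \<open>The largest exponent that can occur; counting down from it gives a subsum of a geometric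
    series.\<close>
  define m where "m = \<lfloor>log 2 z\<rfloor>"
  define r :: real where "r = 2 powr - \<alpha>"
  have r: "0 < r" "r < 1"
    using powr_less_mono[of "-\<alpha>" 0 2] assms by (auto simp: r_def)
  define K' where "K' = {k \<in> K. 2 powr real_of_int k \<le> z}"
  have le_m: "k \<le> m" if "k \<in> K'" for k
    using that assms by (simp add: K'_def m_def le_floor_iff le_log_iff)
  have eq: "2 powr (\<alpha> * real_of_int k) = 2 powr (\<alpha> * real_of_int m) * r ^ nat (m - k)"
    if "k \<in> K'" for k
  proof -
    have "r ^ nat (m - k) = 2 powr (- \<alpha> * real (nat (m - k)))"
      using r by (simp add: r_def powr_powr flip: powr_realpow)
    also have "real (nat (m - k)) = real_of_int m - real_of_int k"
      using le_m[OF that] by simp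
    finally show ?thesis
      by (simp add: powr_add[symmetric] algebra_simps)
  qed
  have inj: "inj_on (\<lambda>k. nat (m - k)) K'"
    by (rule inj_onI) (use le_m in \<open>force simp: nat_eq_iff\<close>)
  have "(\<Sum>k\<in>K'. r ^ nat (m - k)) = (\<Sum>i\<in>(\<lambda>k. nat (m - k)) ` K'. r ^ i)"
    using sum.reindex[OF inj, of "\<lambda>i. r ^ i"] by simp
  also have "\<dots> \<le> (\<Sum>i. r ^ i)"
    using r assms by (intro sum_le_suminf summable_geometric) (auto simp: K'_def)
  also have "\<dots> = 1 / (1 - r)"
    using r by (intro suminf_geometric) auto
  finally have geo: "(\<Sum>k\<in>K'. r ^ nat (m - k)) \<le> 1 / (1 - r)" .
  have "(\<Sum>k\<in>K'. 2 powr (\<alpha> * real_of_int k))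
      = 2 powr (\<alpha> * real_of_int m) * (\<Sum>k\<in>K'. r ^ nat (m - k))"
    by (simp add: eq sum_distrib_left)
  also have "\<dots> \<le> z powr \<alpha> * (1 / (1 - r))"
  proof (intro mult_mono geo)
    have "2 powr real_of_int m \<le> z"
      using assms by (simp add: m_def powr_le_iff)
    then have "(2 powr real_of_int m) powr \<alpha> \<le> z powr \<alpha>"
      using assms by (intro powr_mono2) auto
    then show "2 powr (\<alpha> * real_of_int m) \<le> z powr \<alpha>"
      by (simp add: powr_powr mult.commute)
  qed (use r in \<open>auto intro!: sum_nonneg\<close>)
  finally show ?thesis
    by (simp add: K'_def r_def)
qed

text \<open>The reflection \<open>k \<mapsto> -k\<close> turns this into the preceding sum.\<close>

lemma geometric_sum_above:
  assumes "\<beta> > 0" "z > 0" "finite K"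
  shows "(\<Sum>k | k \<in> K \<and> z \<le> 2 powr real_of_int k. 2 powr - (\<beta> * real_of_int k))
    \<le> z powr - \<beta> / (1 - 2 powr - \<beta>)"
proof -
  have inj: "inj_on uminus X" for X :: "int set"
    by simp
  have "(\<Sum>k | k \<in> uminus ` K \<and> 2 powr real_of_int k \<le> 1 / z. 2 powr (\<beta> * real_of_int k))
      \<le> (1 / z) powr \<beta> / (1 - 2 powr - \<beta>)"
    using assms by (intro geometric_sum_below) auto
  also have "{k \<in> uminus ` K. 2 powr real_of_int k \<le> 1 / z}
      = uminus ` {k \<in> K. z \<le> 2 powr real_of_int k}"
    using assms by (auto simp: powr_minus field_simps)
  also have "(\<Sum>k\<in>\<dots>. 2 powr (\<beta> * real_of_int k))
      = (\<Sum>k | k \<in> K \<and> z \<le> 2 powr real_of_int k. 2 powr - (\<beta> * real_of_int k))"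
    by (simp add: sum.reindex)
  also have "(1 / z) powr \<beta> = z powr - \<beta>"
    using assms by (simp add: powr_divide powr_minus_divide)
  finally show ?thesis .
qed

section \<open>The weighted Bessel inequality\<close>

definition cut_above :: "real \<Rightarrow> ('a \<Rightarrow> complex) \<Rightarrow> 'a \<Rightarrow> complex" where
  "cut_above t f x = (if cmod (f x) > t then f x else 0)"

definition cut_below :: "real \<Rightarrow> ('a \<Rightarrow> complex) \<Rightarrow> 'a \<Rightarrow> complex" where
  "cut_below t f x = (if cmod (f x) > t then 0 else f x)"

lemma measurable_cut_above [measurable]:
  assumes [measurable]: "f \<in> borel_measurable M"
  shows "cut_above t f \<in> borel_measurable M"
  unfolding cut_above_def by measurable

lemma measurable_cut_below [measurable]:
  assumes [measurable]: "f \<in> borel_measurable M"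
  shows "cut_below t f \<in> borel_measurable M"
  unfolding cut_below_def by measurable

lemma Lp_space_2_cut:
  assumes "f \<in> Lp_space 2"
  shows "cut_above t f \<in> Lp_space 2" "cut_below t f \<in> Lp_space 2"
  by (rule Lp_space_2_dominated[OF assms, of _ 1];
      use measurable_Lp_space[OF assms] in \<open>auto simp: cut_above_def cut_below_def\<close>)+

text \<open>On the set where \<open>\<bar>f\<bar> > t\<close>, the ratio of \<open>\<bar>f\<bar>\<close> to \<open>\<bar>f\<bar>\<^sup>p\<close> is at most \<open>t\<^sup>1\<^sup>-\<^sup>p\<close>.\<close>

lemma L1_norm_cut_above_le:
  assumes "t > 0" "p > 1" and f: "f \<in> borel_measurable lebesgue"
    and "(\<integral>\<^sup>+x. ennreal (cmod (f x) powr p) \<partial>lebesgue) \<le> 1"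
  shows "(\<integral>\<^sup>+x. ennreal (cmod (cut_above t f x)) \<partial>lebesgue) \<le> ennreal (t powr (1 - p))"
proof -
  note [measurable] = f
  have "cmod (cut_above t f x) \<le> t powr (1 - p) * cmod (f x) powr p" for x
  proof (cases "cmod (f x) > t")
    case True
    define y where "y = cmod (f x)"
    have y: "y > t"
      using True by (simp add: y_def)
    have "y = y powr (1 - p) * y powr p"
      using y assms by (simp flip: powr_add)
    also have "\<dots> \<le> t powr (1 - p) * y powr p"
      using y assms by (intro mult_right_mono powr_mono2') auto
    finally show ?thesis
      using True by (simp add: cut_above_def y_def)
  qed (simp add: cut_above_def)
  then have "(\<integral>\<^sup>+x. ennreal (cmod (cut_above t f x)) \<partial>lebesgue)
      \<le> (\<integral>\<^sup>+x. ennreal (t powr (1 - p)) * ennreal (cmod (f x) powr p) \<partial>lebesgue)"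
    by (intro nn_integral_mono) (simp flip: ennreal_mult)
  also have "\<dots> = ennreal (t powr (1 - p)) * (\<integral>\<^sup>+x. ennreal (cmod (f x) powr p) \<partial>lebesgue)"
    by (rule nn_integral_cmult) simp
  also have "\<dots> \<le> ennreal (t powr (1 - p)) * 1"
    by (rule mult_left_mono) (use assms in auto)
  finally show ?thesis
    by simp
qed

text \<open>The large part of \<open>f\<close> is integrable, and its coefficients are controlled one by one by the sup norms
  of the \<open>u j\<close>; the small part goes into Bessel's inequality. The square of the \<open>L\<^sup>1\<close> norm of the
  large part is kept as a product of which only one factor is estimated: the remaining factor is linear
  in \<open>\<bar>f\<bar>\<close>, so that the bounds for different levels can be summed under the integral.\<close>

lemma one_level_bound:
  assumes u: "orthonormal_basis u" and f: "f \<in> Lp_space 2"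
    and "t > 0" "p > 1" "finite G"
    and fp: "(\<integral>\<^sup>+x. ennreal (cmod (f x) powr p) \<partial>lebesgue) \<le> 1"
    and v: "(\<Sum>j\<in>G. (Linf_norm (u j))\<^sup>2) \<le> ennreal v"
  shows "(\<Sum>j\<in>G. ennreal ((cmod (L2_inner f (u j)))\<^sup>2))
    \<le> 2 * (ennreal v * ennreal (t powr (1 - p))
              * (\<integral>\<^sup>+x. ennreal (cmod (cut_above t f x)) \<partial>lebesgue)
            + (\<integral>\<^sup>+x. ennreal ((cmod (cut_below t f x))\<^sup>2) \<partial>lebesgue))"
proof -
  define a where "a j = cmod (L2_inner (cut_above t f) (u j))" for j
  define b where "b j = cmod (L2_inner (cut_below t f) (u j))" for j
  have uL: "u j \<in> Lp_space 2" for j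
    using u by (simp add: orthonormal_basis_def)
  have fm: "f \<in> borel_measurable lebesgue"
    by (rule measurable_Lp_space[OF f])
  define I where "I = (\<integral>\<^sup>+x. ennreal (cmod (cut_above t f x)) \<partial>lebesgue)"
  have I: "I \<le> ennreal (t powr (1 - p))"
    unfolding I_def by (rule L1_norm_cut_above_le) (use assms fm in auto)
  have split: "(cmod (L2_inner f (u j)))\<^sup>2 \<le> 2 * (a j)\<^sup>2 + 2 * (b j)\<^sup>2" for j
  proof -
    have "L2_inner f (u j) = L2_inner (cut_above t f) (u j) + L2_inner (cut_below t f) (u j)"
      using L2_inner_add_left[OF Lp_space_2_cut[OF f] uL, of t t j]
      by (simp add: cut_above_def cut_below_def if_distrib cong: if_cong)
    then have "cmod (L2_inner f (u j)) \<le> a j + b j"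
      by (simp add: a_def b_def norm_triangle_ineq)
    then have "(cmod (L2_inner f (u j)))\<^sup>2 \<le> (a j + b j)\<^sup>2"
      by (intro power_mono) auto
    then show ?thesis
      using sum_squares_bound[of "a j" "b j"] by (simp add: power2_sum)
  qed
  have "(\<Sum>j\<in>G. ennreal ((cmod (L2_inner f (u j)))\<^sup>2))
      \<le> (\<Sum>j\<in>G. ennreal (2 * (a j)\<^sup>2 + 2 * (b j)\<^sup>2))"
    by (intro sum_mono ennreal_leI split)
  also have "\<dots> = 2 * ((\<Sum>j\<in>G. (ennreal (a j))\<^sup>2) + (\<Sum>j\<in>G. ennreal ((b j)\<^sup>2)))"
    by (simp add: ennreal_plus ennreal_mult ennreal_power a_def sum.distrib sum_distrib_left
        distrib_left del: sum_ennreal)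
  also have "\<dots> \<le> 2 * (ennreal v * ennreal (t powr (1 - p)) * I
      + (\<integral>\<^sup>+x. ennreal ((cmod (cut_below t f x))\<^sup>2) \<partial>lebesgue))"
  proof (intro mult_left_mono add_mono)
    have "(\<Sum>j\<in>G. (ennreal (a j))\<^sup>2) \<le> (\<Sum>j\<in>G. (Linf_norm (u j) * I)\<^sup>2)"
      unfolding a_def I_def
      by (intro sum_mono power_mono Fourier_coefficient_le_L1)
        (use fm uL in \<open>auto intro: measurable_Lp_space\<close>)
    also have "\<dots> = (\<Sum>j\<in>G. (Linf_norm (u j))\<^sup>2) * I * I"
      unfolding sum_distrib_right
      by (intro sum.cong) (simp_all add: power_mult_distrib power2_eq_square mult_ac)
    also have "\<dots> \<le> ennreal v * ennreal (t powr (1 - p)) * I"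
      by (intro mult_right_mono mult_mono v I) auto
    finally show "(\<Sum>j\<in>G. (ennreal (a j))\<^sup>2) \<le> ennreal v * ennreal (t powr (1 - p)) * I" .
    have "(\<Sum>j\<in>G. ennreal ((b j)\<^sup>2)) = ennreal (\<Sum>j\<in>G. (b j)\<^sup>2)"
      by simp
    also have "\<dots> \<le> ennreal (Re (L2_inner (cut_below t f) (cut_below t f)))"
      unfolding b_def
      by (intro ennreal_leI Bessel_inequality[OF u Lp_space_2_cut(2)[OF f]] assms)
    also have "\<dots> = (\<integral>\<^sup>+x. ennreal ((cmod (cut_below t f x))\<^sup>2) \<partial>lebesgue)"
      using nn_integral_L2_inner_self[OF Lp_space_2_cut(2)[OF f]] by simp
    finally show "(\<Sum>j\<in>G. ennreal ((b j)\<^sup>2))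
        \<le> (\<integral>\<^sup>+x. ennreal ((cmod (cut_below t f x))\<^sup>2) \<partial>lebesgue)" .
  qed auto
  finally show ?thesis
    by (simp add: I_def)
qed

text \<open>The height at which \<open>f\<close> is split when the weight is about \<open>2\<^sup>k\<close>. The exponent is the one for which
  \<open>\<Sum> 4\<^sup>k \<bar>f\<bar>\<^sup>2\<close>, taken over those \<open>k\<close> for which \<open>\<bar>f\<bar>\<close> lies below the height, is comparable
  to \<open>\<bar>f\<bar>\<^sup>p\<close>; the sum over the large parts then scales in the same way.\<close>

definition cut_height :: "real \<Rightarrow> int \<Rightarrow> real" where
  "cut_height p k = 2 powr (- 2 * real_of_int k / (2 - p))"

lemma cut_height_pos: "cut_height p k > 0"
  by (simp add: cut_height_def)

lemma le_cut_height_iff: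
  assumes "p < 2" "y > 0"
  shows "y \<le> cut_height p k \<longleftrightarrow> 2 powr real_of_int k \<le> y powr (- (2 - p) / 2)"
proof -
  have h: "cut_height p k powr (- (2 - p) / 2) = 2 powr real_of_int k"
  proof -
    have "- 2 * real_of_int k / (2 - p) * (- (2 - p) / 2) = real_of_int k"
      using assms by (simp add: field_simps)
    then show ?thesis
      unfolding cut_height_def powr_powr by simp
  qed
  have "cut_height p k powr (- (2 - p) / 2) \<le> y powr (- (2 - p) / 2)" if "y \<le> cut_height p k"
    using that assms by (intro powr_mono2') auto
  moreover have "y powr (- (2 - p) / 2) < cut_height p k powr (- (2 - p) / 2)"
    if "y > cut_height p k"
    using that assms cut_height_pos[of p k] by (intro powr_less_mono2_neg) auto
  ultimately show ?thesis
    unfolding h by (meson not_le)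
qed

lemma sum_cut_below_le:
  assumes "p < 2" "finite K"
  shows "(\<Sum>k\<in>K. 2 powr (2 * real_of_int k) * (cmod (cut_below (cut_height p k) f x))\<^sup>2)
    \<le> cmod (f x) powr p / (1 - 2 powr - 2)"
proof (cases "f x = 0")
  case False
  define y where "y = cmod (f x)"
  have y: "y > 0"
    using False by (simp add: y_def)
  have "(\<Sum>k\<in>K. 2 powr (2 * real_of_int k) * (cmod (cut_below (cut_height p k) f x))\<^sup>2)
      = (\<Sum>k\<in>K. if y \<le> cut_height p k then 2 powr (2 * real_of_int k) * y\<^sup>2 else 0)"
    by (intro sum.cong) (auto simp: cut_below_def y_def)
  also have "\<dots> = y\<^sup>2 * (\<Sum>k | k \<in> K \<and> y \<le> cut_height p k. 2 powr (2 * real_of_int k))"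
    unfolding sum.inter_filter[OF \<open>finite K\<close>] sum_distrib_left by (intro sum.cong) auto
  also have "\<dots> \<le> y\<^sup>2 * ((y powr (- (2 - p) / 2)) powr 2 / (1 - 2 powr - 2))"
    unfolding le_cut_height_iff[OF \<open>p < 2\<close> y]
    by (intro mult_left_mono geometric_sum_below) (use y assms in auto)
  also have "y\<^sup>2 = y powr 2"
    using y by simp
  also have "y powr 2 * ((y powr (- (2 - p) / 2)) powr 2 / (1 - 2 powr - 2))
      = y powr p / (1 - 2 powr - 2)"
  proof -
    have "2 + - (2 - p) / 2 * 2 = p"
      by (simp add: field_simps)
    then show ?thesis
      unfolding powr_powr times_divide_eq_right powr_add[symmetric] by (simp only:)
  qed
  finally show ?thesis
    by (simp add: y_def)
next
  case True
  then have "cut_below t f x = 0" for t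
    by (simp add: cut_below_def)
  then show ?thesis
    using True by simp
qed

lemma sum_cut_above_le:
  assumes "1 < p" "p < 2" "finite K"
  defines "\<beta> \<equiv> (2 * p - 2) / (2 - p)"
  shows "(\<Sum>k\<in>K. 2 powr - (\<beta> * real_of_int k) * cmod (cut_above (cut_height p k) f x))
    \<le> cmod (f x) powr p / (1 - 2 powr - \<beta>)"
proof (cases "f x = 0")
  case False
  define y where "y = cmod (f x)"
  define z where "z = y powr (- (2 - p) / 2)"
  have y: "y > 0"
    using False by (simp add: y_def)
  have \<beta>: "\<beta> > 0"
    using assms by (simp add: \<beta>_def)
  have "(\<Sum>k\<in>K. 2 powr - (\<beta> * real_of_int k) * cmod (cut_above (cut_height p k) f x))
      = (\<Sum>k\<in>K. if cut_height p k < y then 2 powr - (\<beta> * real_of_int k) * y else 0)"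
    by (intro sum.cong) (auto simp: cut_above_def y_def)
  also have "\<dots> = y * (\<Sum>k | k \<in> K \<and> cut_height p k < y. 2 powr - (\<beta> * real_of_int k))"
    unfolding sum.inter_filter[OF \<open>finite K\<close>] sum_distrib_left by (intro sum.cong) auto
  also have "\<dots> \<le> y * (\<Sum>k | k \<in> K \<and> z \<le> 2 powr real_of_int k. 2 powr - (\<beta> * real_of_int k))"
    using y assms le_cut_height_iff[OF \<open>p < 2\<close> y]
    by (intro mult_left_mono sum_mono2) (auto simp: z_def not_le[symmetric])
  also have "\<dots> \<le> y * (z powr - \<beta> / (1 - 2 powr - \<beta>))"
    by (intro mult_left_mono geometric_sum_above) (use y assms \<beta> in \<open>auto simp: z_def\<close>)
  also have "z powr - \<beta> = y powr (p - 1)"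
  proof -
    have "- (2 - p) / 2 * - \<beta> = p - 1"
      using assms by (simp add: \<beta>_def field_simps)
    then show ?thesis
      unfolding z_def powr_powr by simp
  qed
  also have "y * (y powr (p - 1) / (1 - 2 powr - \<beta>)) = y powr p / (1 - 2 powr - \<beta>)"
    using y by (simp add: powr_mult_base)
  finally show ?thesis
    by (simp add: y_def)
next
  case True
  then have "cut_above t f x = 0" for t
    by (simp add: cut_above_def)
  then show ?thesis
    using True by simp
qed

text \<open>The first summand comes from the large parts, the second one from the small parts. For \<open>p = 2\<close> the
  inequality to be proved is Bessel's, with constant \<open>1\<close>.\<close>

definition Paley_const :: "real \<Rightarrow> real" where
  "Paley_const p = (if p = 2 then 1 else
    2 * (2 powr (2 * p / (2 - p)) / (1 - 2 powr - ((2 * p - 2) / (2 - p)))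
      + 1 / (1 - 2 powr - 2)))"

lemma Paley_const_pos:
  assumes "1 < p" "p \<le> 2"
  shows "Paley_const p > 0"
proof (cases "p = 2")
  case False
  have "2 powr - ((2 * p - 2) / (2 - p)) < (2::real) powr 0"
    using assms False by (intro powr_less_mono) auto
  moreover have "2 powr - 2 < (2::real) powr 0"
    by (intro powr_less_mono) auto
  ultimately show ?thesis
    using False by (simp add: Paley_const_def add_pos_pos)
qed (simp add: Paley_const_def)

text \<open>Exchanging the sum over the levels with the integrals reduces the bound to the two pointwise
  geometric sums. The factor \<open>(2\<^sup>k\<^sup>-\<^sup>1) powr - (2 p / (2 - p))\<close> is the bound for the sum of the squared sup
  norms over a level.\<close>

lemma sum_levels_le:
  assumes p: "1 < p" "p < 2" and "finite K" and f: "f \<in> borel_measurable lebesgue"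
    and fp: "(\<integral>\<^sup>+x. ennreal (cmod (f x) powr p) \<partial>lebesgue) \<le> 1"
  shows "(\<Sum>k\<in>K. ennreal (2 powr (2 * real_of_int k)) * (2 *
      (ennreal ((2 powr (real_of_int k - 1)) powr - (2 * p / (2 - p)))
          * ennreal (cut_height p k powr (1 - p))
          * (\<integral>\<^sup>+x. ennreal (cmod (cut_above (cut_height p k) f x)) \<partial>lebesgue)
        + (\<integral>\<^sup>+x. ennreal ((cmod (cut_below (cut_height p k) f x))\<^sup>2) \<partial>lebesgue))))
    \<le> ennreal (Paley_const p)"
proof -
  note [measurable] = f
  define \<beta> where "\<beta> = (2 * p - 2) / (2 - p)"
  define D where "D = (2::real) powr (2 * p / (2 - p))"
  define Ca where "Ca = D / (1 - 2 powr - \<beta>)"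
  define Cb where "Cb = 1 / (1 - 2 powr - (2::real))"
  have \<beta>: "\<beta> > 0"
    using p by (simp add: \<beta>_def)
  have C0: "D \<ge> 0" "Ca \<ge> 0" "Cb \<ge> 0"
    using \<beta> powr_less_mono[of "-\<beta>" 0 2] powr_less_mono[of "-2" 0 2]
    by (auto simp: Ca_def Cb_def D_def)
  define A where "A k = (\<integral>\<^sup>+x. ennreal (cmod (cut_above (cut_height p k) f x)) \<partial>lebesgue)" for k
  define B where "B k = (\<integral>\<^sup>+x. ennreal ((cmod (cut_below (cut_height p k) f x))\<^sup>2) \<partial>lebesgue)" for k
  have coeff: "ennreal (2 powr (2 * real_of_int k)) *
      (ennreal ((2 powr (real_of_int k - 1)) powr - (2 * p / (2 - p)))
          * ennreal (cut_height p k powr (1 - p)))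
      = ennreal (D * 2 powr - (\<beta> * real_of_int k))" for k
  proof -
    have e: "2 * real_of_int k + ((real_of_int k - 1) * - (2 * p / (2 - p))
        + - 2 * real_of_int k / (2 - p) * (1 - p))
        = 2 * p / (2 - p) + - (\<beta> * real_of_int k)"
      using p by (simp add: \<beta>_def divide_simps) (simp add: algebra_simps)
    show ?thesis
      unfolding cut_height_def powr_powr D_def
      by (simp only: e powr_ge_zero mult_nonneg_nonneg
          flip: ennreal_mult powr_add)
  qed
  have "(\<Sum>k\<in>K. ennreal (2 powr (2 * real_of_int k)) * (2 *
      (ennreal ((2 powr (real_of_int k - 1)) powr - (2 * p / (2 - p)))
          * ennreal (cut_height p k powr (1 - p)) * A k + B k)))
      = 2 * ((\<Sum>k\<in>K. ennreal (D * 2 powr - (\<beta> * real_of_int k)) * A k)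
           + (\<Sum>k\<in>K. ennreal (2 powr (2 * real_of_int k)) * B k))"
    unfolding coeff[symmetric]
    by (simp add: distrib_left sum.distrib sum_distrib_left mult_ac)
  also have "\<dots> \<le> 2 * (ennreal Ca + ennreal Cb)"
  proof (intro mult_left_mono add_mono)
    have "(\<Sum>k\<in>K. ennreal (D * 2 powr - (\<beta> * real_of_int k)) * A k)
        = (\<integral>\<^sup>+x. (\<Sum>k\<in>K. ennreal (D * 2 powr - (\<beta> * real_of_int k))
             * ennreal (cmod (cut_above (cut_height p k) f x))) \<partial>lebesgue)"
      unfolding A_def by (subst nn_integral_sum) (simp_all add: nn_integral_cmult)
    also have "\<dots> \<le> (\<integral>\<^sup>+x. ennreal Ca * ennreal (cmod (f x) powr p) \<partial>lebesgue)"
    proof (rule nn_integral_mono)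
      fix x
      have "(\<Sum>k\<in>K. ennreal (D * 2 powr - (\<beta> * real_of_int k))
             * ennreal (cmod (cut_above (cut_height p k) f x)))
          = ennreal (D * (\<Sum>k\<in>K. 2 powr - (\<beta> * real_of_int k)
             * cmod (cut_above (cut_height p k) f x)))"
        using C0 by (simp add: sum_distrib_left mult.assoc flip: ennreal_mult)
      also have "\<dots> \<le> ennreal (D * (cmod (f x) powr p / (1 - 2 powr - \<beta>)))"
        using sum_cut_above_le[OF p \<open>finite K\<close>, of f x] C0
        by (intro ennreal_leI mult_left_mono) (simp_all add: \<beta>_def)
      also have "\<dots> = ennreal Ca * ennreal (cmod (f x) powr p)"
        using C0 by (simp add: Ca_def flip: ennreal_mult)
      finally show "(\<Sum>k\<in>K. ennreal (D * 2 powr - (\<beta> * real_of_int k))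
             * ennreal (cmod (cut_above (cut_height p k) f x)))
          \<le> ennreal Ca * ennreal (cmod (f x) powr p)" .
    qed
    also have "\<dots> = ennreal Ca * (\<integral>\<^sup>+x. ennreal (cmod (f x) powr p) \<partial>lebesgue)"
      by (rule nn_integral_cmult) simp
    also have "\<dots> \<le> ennreal Ca * 1"
      by (intro mult_left_mono fp) simp
    finally show "(\<Sum>k\<in>K. ennreal (D * 2 powr - (\<beta> * real_of_int k)) * A k) \<le> ennreal Ca"
      by simp
    have "(\<Sum>k\<in>K. ennreal (2 powr (2 * real_of_int k)) * B k)
        = (\<integral>\<^sup>+x. (\<Sum>k\<in>K. ennreal (2 powr (2 * real_of_int k))
             * ennreal ((cmod (cut_below (cut_height p k) f x))\<^sup>2)) \<partial>lebesgue)"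
      unfolding B_def by (subst nn_integral_sum) (simp_all add: nn_integral_cmult)
    also have "\<dots> \<le> (\<integral>\<^sup>+x. ennreal Cb * ennreal (cmod (f x) powr p) \<partial>lebesgue)"
    proof (rule nn_integral_mono)
      fix x
      have "(\<Sum>k\<in>K. ennreal (2 powr (2 * real_of_int k))
             * ennreal ((cmod (cut_below (cut_height p k) f x))\<^sup>2))
          = ennreal (\<Sum>k\<in>K. 2 powr (2 * real_of_int k)
             * (cmod (cut_below (cut_height p k) f x))\<^sup>2)"
        by (simp flip: ennreal_mult)
      also have "\<dots> \<le> ennreal (cmod (f x) powr p / (1 - 2 powr - 2))"
        by (intro ennreal_leI sum_cut_below_le p assms)
      also have "\<dots> = ennreal Cb * ennreal (cmod (f x) powr p)"
        using C0 by (simp add: Cb_def flip: ennreal_mult)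
      finally show "(\<Sum>k\<in>K. ennreal (2 powr (2 * real_of_int k))
             * ennreal ((cmod (cut_below (cut_height p k) f x))\<^sup>2))
          \<le> ennreal Cb * ennreal (cmod (f x) powr p)" .
    qed
    also have "\<dots> = ennreal Cb * (\<integral>\<^sup>+x. ennreal (cmod (f x) powr p) \<partial>lebesgue)"
      by (rule nn_integral_cmult) simp
    also have "\<dots> \<le> ennreal Cb * 1"
      by (intro mult_left_mono fp) simp
    finally show "(\<Sum>k\<in>K. ennreal (2 powr (2 * real_of_int k)) * B k) \<le> ennreal Cb"
      by simp
  qed auto
  also have "\<dots> = ennreal (2 * (Ca + Cb))"
    using C0 by (simp add: ennreal_mult)
  also have "2 * (Ca + Cb) = Paley_const p"
    using p by (simp add: Ca_def Cb_def D_def \<beta>_def Paley_const_def)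
  finally show ?thesis
    unfolding A_def B_def .
qed

text \<open>Splitting the indices into the levels \<open>2\<^sup>k\<^sup>-\<^sup>1 < \<phi> j \<le> 2\<^sup>k\<close> and the function, for each level, at its
  own height is Marcinkiewicz interpolation between \<open>L\<^sup>1\<close> and \<open>L\<^sup>2\<close>, carried out by hand.\<close>

lemma weighted_Bessel_normalized:
  assumes u: "orthonormal_basis u" and p: "1 < p" "p < 2"
    and f: "f \<in> Lp_space 2"
    and fp: "(\<integral>\<^sup>+x. ennreal (cmod (f x) powr p) \<partial>lebesgue) \<le> 1"
    and \<phi>0: "\<And>j. \<phi> j \<ge> 0"
    and \<phi>: "\<And>s G. s > 0 \<Longrightarrow> finite G \<Longrightarrow> (\<And>j. j \<in> G \<Longrightarrow> \<phi> j > s) \<Longrightarrow>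
      (\<Sum>j\<in>G. (Linf_norm (u j))\<^sup>2) \<le> ennreal (s powr - (2 * p / (2 - p)))"
    and "finite F"
  shows "(\<Sum>j\<in>F. ennreal ((\<phi> j * cmod (L2_inner f (u j)))\<^sup>2)) \<le> ennreal (Paley_const p)"
proof -
  define F' where "F' = {j \<in> F. \<phi> j > 0}"
  define \<kappa> where "\<kappa> j = \<lceil>log 2 (\<phi> j)\<rceil>" for j
  have finF': "finite F'"
    using \<open>finite F\<close> by (simp add: F'_def)
  have level: "2 powr (real_of_int (\<kappa> j) - 1) < \<phi> j" "\<phi> j \<le> 2 powr real_of_int (\<kappa> j)"
    if "\<phi> j > 0" for j
    using ceiling_correct[of "log 2 (\<phi> j)"] that
    unfolding \<kappa>_def[symmetric] by (simp_all add: less_log_iff log_le_iff)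
  define c where "c j = ennreal ((cmod (L2_inner f (u j)))\<^sup>2)" for j
  have "(\<Sum>j\<in>F. ennreal ((\<phi> j * cmod (L2_inner f (u j)))\<^sup>2))
      = (\<Sum>j\<in>F'. ennreal ((\<phi> j * cmod (L2_inner f (u j)))\<^sup>2))"
    unfolding F'_def using \<phi>0 \<open>finite F\<close>
    by (intro sum.mono_neutral_right) (auto simp: less_le)
  also have "\<dots> = (\<Sum>k\<in>\<kappa> ` F'. \<Sum>j | j \<in> F' \<and> \<kappa> j = k.
      ennreal ((\<phi> j * cmod (L2_inner f (u j)))\<^sup>2))"
    by (rule sum.image_gen[OF finF'])
  also have "\<dots> \<le> (\<Sum>k\<in>\<kappa> ` F'. ennreal (2 powr (2 * real_of_int k)) *
      (\<Sum>j | j \<in> F' \<and> \<kappa> j = k. c j))"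
    unfolding sum_distrib_left
  proof (intro sum_mono)
    fix k j assume "j \<in> {j \<in> F'. \<kappa> j = k}"
    then have "\<phi> j \<le> 2 powr real_of_int k"
      using level by (auto simp: F'_def)
    then have "(\<phi> j)\<^sup>2 \<le> (2 powr real_of_int k)\<^sup>2"
      using \<phi>0 by (intro power_mono)
    also have "\<dots> = 2 powr (2 * real_of_int k)"
      by (simp add: power2_eq_square flip: powr_add)
    finally show "ennreal ((\<phi> j * cmod (L2_inner f (u j)))\<^sup>2)
        \<le> ennreal (2 powr (2 * real_of_int k)) * c j"
      by (simp add: c_def power_mult_distrib mult_right_mono flip: ennreal_mult)
  qed
  also have "\<dots> \<le> (\<Sum>k\<in>\<kappa> ` F'. ennreal (2 powr (2 * real_of_int k)) * (2 *
      (ennreal ((2 powr (real_of_int k - 1)) powr - (2 * p / (2 - p)))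
          * ennreal (cut_height p k powr (1 - p))
          * (\<integral>\<^sup>+x. ennreal (cmod (cut_above (cut_height p k) f x)) \<partial>lebesgue)
        + (\<integral>\<^sup>+x. ennreal ((cmod (cut_below (cut_height p k) f x))\<^sup>2) \<partial>lebesgue))))"
    unfolding c_def
  proof (intro sum_mono mult_left_mono one_level_bound[OF u f _ p(1) _ fp] \<phi>)
    show "2 powr (real_of_int k - 1) < \<phi> j" if "j \<in> {j \<in> F'. \<kappa> j = k}" for k j
      using that level by (auto simp: F'_def)
  qed (use finF' cut_height_pos in auto)
  also have "\<dots> \<le> ennreal (Paley_const p)"
    by (rule sum_levels_le) (use finF' p fp f in \<open>auto intro: measurable_Lp_space\<close>)
  finally show ?thesis .
qed

text \<open>A Paley type inequality: a weight that is small in the weak sense of the tail condition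
  maps \<open>L\<^sup>p\<close> to square summable coefficients. The inequality is homogeneous in the weight and in
  the function, so the normalized case suffices if \<open>p < 2\<close>.\<close>

lemma weighted_Bessel:
  assumes u: "orthonormal_basis u" and p: "1 < p" "p \<le> 2"
    and f: "f \<in> Lp_space 2" and BN: "B > 0" "N > 0"
    and fp: "(\<integral>\<^sup>+x. ennreal (cmod (f x) powr p) \<partial>lebesgue) \<le> ennreal (N powr p)"
    and \<phi>0: "\<And>j. \<phi> j \<ge> 0"
    and weak: "\<And>s G. p < 2 \<Longrightarrow> s > 0 \<Longrightarrow> finite G \<Longrightarrow> (\<And>j. j \<in> G \<Longrightarrow> \<phi> j > s) \<Longrightarrow>
      (\<Sum>j\<in>G. (Linf_norm (u j))\<^sup>2) \<le> ennreal ((B / s) powr (2 * p / (2 - p)))"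
    and bounded: "\<And>j. p = 2 \<Longrightarrow> \<phi> j \<le> B"
    and "finite F"
  shows "(\<Sum>j\<in>F. (\<phi> j * cmod (L2_inner f (u j)))\<^sup>2) \<le> Paley_const p * (B * N)\<^sup>2"
proof (cases "p = 2")
  case True
  have "(\<Sum>j\<in>F. (\<phi> j * cmod (L2_inner f (u j)))\<^sup>2)
      \<le> (\<Sum>j\<in>F. B\<^sup>2 * (cmod (L2_inner f (u j)))\<^sup>2)"
    unfolding power_mult_distrib
    by (intro sum_mono mult_right_mono power_mono) (use True bounded \<phi>0 in auto)
  also have "\<dots> = B\<^sup>2 * (\<Sum>j\<in>F. (cmod (L2_inner f (u j)))\<^sup>2)"
    by (simp add: sum_distrib_left)
  also have "\<dots> \<le> B\<^sup>2 * Re (L2_inner f f)"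
    by (intro mult_left_mono Bessel_inequality u f assms) simp
  also have "\<dots> \<le> B\<^sup>2 * N\<^sup>2"
  proof (rule mult_left_mono)
    have "ennreal (Re (L2_inner f f)) \<le> ennreal (N\<^sup>2)"
      using fp True BN by (simp add: nn_integral_L2_inner_self[OF f])
    then show "Re (L2_inner f f) \<le> N\<^sup>2"
      by simp
  qed simp
  finally show ?thesis
    using True by (simp add: Paley_const_def power_mult_distrib)
next
  case False
  with p have p2: "p < 2"
    by simp
  define f' where "f' = (\<lambda>x. of_real (1 / N) * f x)"
  have f': "f' \<in> Lp_space 2"
    unfolding f'_def by (rule Lp_space_2_scale[OF f])
  have coeff: "L2_inner f' (u j) = L2_inner f (u j) / of_real N" for j
    using L2_inner_scale_left[of "of_real (1 / N)" f] by (simp add: f'_def)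
  have [measurable]: "f \<in> borel_measurable lebesgue"
    by (rule measurable_Lp_space[OF f])
  have "(\<integral>\<^sup>+x. ennreal (cmod (f' x) powr p) \<partial>lebesgue)
      = (\<integral>\<^sup>+x. ennreal (1 / N powr p) * ennreal (cmod (f x) powr p) \<partial>lebesgue)"
    using BN by (simp add: f'_def norm_mult norm_divide powr_divide flip: ennreal_mult)
  also have "\<dots> = ennreal (1 / N powr p) * (\<integral>\<^sup>+x. ennreal (cmod (f x) powr p) \<partial>lebesgue)"
    by (rule nn_integral_cmult) simp
  also have "\<dots> \<le> ennreal (1 / N powr p) * ennreal (N powr p)"
    by (intro mult_left_mono fp) simp
  also have "\<dots> = 1"
    using BN by (simp flip: ennreal_mult)
  finally have f'p: "(\<integral>\<^sup>+x. ennreal (cmod (f' x) powr p) \<partial>lebesgue) \<le> 1" .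
  have "(\<Sum>j\<in>F. ennreal ((\<phi> j / B * cmod (L2_inner f' (u j)))\<^sup>2)) \<le> ennreal (Paley_const p)"
  proof (rule weighted_Bessel_normalized[OF u p(1) p2 f' f'p _ _ \<open>finite F\<close>])
    fix s :: real and G
    assume "s > 0" "finite G" "\<And>j. j \<in> G \<Longrightarrow> \<phi> j / B > s"
    then have "(\<Sum>j\<in>G. (Linf_norm (u j))\<^sup>2) \<le> ennreal ((B / (B * s)) powr (2 * p / (2 - p)))"
      using BN p2 by (intro weak) (auto simp: field_simps)
    then show "(\<Sum>j\<in>G. (Linf_norm (u j))\<^sup>2) \<le> ennreal (s powr - (2 * p / (2 - p)))"
      using BN \<open>s > 0\<close> by (simp add: powr_divide powr_minus_divide)
  qed (use \<phi>0 BN in auto)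
  moreover have "(\<phi> j / B * cmod (L2_inner f' (u j)))\<^sup>2
      = (\<phi> j * cmod (L2_inner f (u j)))\<^sup>2 / (B * N)\<^sup>2" for j
    using BN by (simp add: coeff norm_divide power_mult_distrib power_divide)
  ultimately have "(\<Sum>j\<in>F. (\<phi> j * cmod (L2_inner f (u j)))\<^sup>2) / (B * N)\<^sup>2 \<le> Paley_const p"
    using Paley_const_pos[OF p] by (simp add: sum_divide_distrib)
  then show ?thesis
    using BN by (simp add: pos_divide_le_eq)
qed

section \<open>Multipliers by duality\<close>

lemma finite_sum_le_ennreal_infsum:
  fixes g :: "'i \<Rightarrow> ennreal"
  assumes "finite G" "G \<subseteq> A"
  shows "sum g G \<le> (\<Sum>\<^sub>\<infinity>j\<in>A. g j)"
  by (subst nonneg_infsum_complete) (use assms in \<open>auto intro!: SUP_upper\<close>)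

lemma weak_type_tail_bound:
  fixes c :: "nat \<Rightarrow> ennreal"
  assumes "s > 0" "a > 0" "B \<ge> 0"
    and weak: "ennreal s * ennpow (\<Sum>\<^sub>\<infinity>j\<in>{j. cmod (\<sigma> j) > s}. c j) a \<le> ennreal B"
    and "finite G" "\<And>j. j \<in> G \<Longrightarrow> cmod (\<sigma> j) > s"
  shows "sum c G \<le> ennreal ((B / s) powr (1 / a))"
proof -
  have "ennreal s * ennpow (\<Sum>\<^sub>\<infinity>j\<in>{j. cmod (\<sigma> j) > s}. c j) a \<le> ennreal s * ennreal (B / s)"
    using weak assms by (simp flip: ennreal_mult)
  then have "ennpow (\<Sum>\<^sub>\<infinity>j\<in>{j. cmod (\<sigma> j) > s}. c j) a \<le> ennreal (B / s)"
    using assms by (subst (asm) ennreal_mult_le_mult_iff) auto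
  then have "(\<Sum>\<^sub>\<infinity>j\<in>{j. cmod (\<sigma> j) > s}. c j) \<le> ennreal ((B / s) powr (1 / a))"
    using assms by (simp add: ennpow_le_ennreal_iff)
  moreover have "sum c G \<le> (\<Sum>\<^sub>\<infinity>j\<in>{j. cmod (\<sigma> j) > s}. c j)"
    using assms by (intro finite_sum_le_ennreal_infsum) auto
  ultimately show ?thesis
    by (rule order_trans[rotated])
qed

text \<open>With exponent \<open>0\<close> the power of a positive tail sum is \<open>1\<close>, so the condition bounds every \<open>s\<close> that is
  exceeded by the symbol somewhere.\<close>

lemma symbol_le_of_weak_type_0:
  fixes c :: "nat \<Rightarrow> ennreal"
  assumes "B \<ge> 0" and c: "\<And>j. c j > 0"
    and weak: "\<And>s. s > 0 \<Longrightarrow> ennreal s * ennpow (\<Sum>\<^sub>\<infinity>j\<in>{j. cmod (\<sigma> j) > s}. c j) 0 \<le> ennreal B"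
  shows "cmod (\<sigma> j) \<le> B"
proof (rule ccontr)
  assume "\<not> cmod (\<sigma> j) \<le> B"
  then obtain s where s: "B < s" "s < cmod (\<sigma> j)"
    using dense[of B "cmod (\<sigma> j)"] by auto
  have "sum c {j} \<le> (\<Sum>\<^sub>\<infinity>i\<in>{i. cmod (\<sigma> i) > s}. c i)"
    using s by (intro finite_sum_le_ennreal_infsum) auto
  with c[of j] have "(\<Sum>\<^sub>\<infinity>i\<in>{i. cmod (\<sigma> i) > s}. c i) > 0"
    by (simp add: order.strict_trans2)
  then have "ennpow (\<Sum>\<^sub>\<infinity>i\<in>{i. cmod (\<sigma> i) > s}. c i) 0 = 1"
    by (auto simp: ennpow_def enn2real_eq_0_iff)
  with weak[of s] s assms show False
    by simp
qed

text \<open>A power of the symbol satisfies a tail condition whose exponent is multiplied by the same number. This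
  allows to distribute the exponent \<open>1/p - 1/q\<close> of the theorem over two applications of the
  weighted Bessel inequality. In the case \<open>r = 2\<close> either the power or the exponent is \<open>0\<close>, and the
  weight is bounded.\<close>

lemma power_of_symbol_weighted_Bessel:
  assumes u: "orthonormal_basis u" and r: "1 < r" "r \<le> 2" and BN: "B > 0" "N > 0"
    and f: "f \<in> Lp_space 2"
    and fp: "(\<integral>\<^sup>+x. ennreal (cmod (f x) powr r) \<partial>lebesgue) \<le> ennreal (N powr r)"
    and \<theta>: "\<theta> \<ge> 0" "a \<ge> 0" "\<theta> * a = 1 / r - 1 / 2"
    and weak: "\<And>s. s > 0 \<Longrightarrow>
      ennreal s * ennpow (\<Sum>\<^sub>\<infinity>j\<in>{j. cmod (\<sigma> j) > s}. (Linf_norm (u j))\<^sup>2) a \<le> ennreal B"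
    and "finite F"
  shows "(\<Sum>j\<in>F. (cmod (\<sigma> j) powr \<theta> * cmod (L2_inner f (u j)))\<^sup>2)
    \<le> Paley_const r * (B powr \<theta> * N)\<^sup>2"
proof (rule weighted_Bessel[OF u r f _ BN(2) fp _ _ _ \<open>finite F\<close>])
  fix s :: real and G
  assume r2: "r < 2" and s: "s > 0" and G: "finite G" "\<And>j. j \<in> G \<Longrightarrow> s < cmod (\<sigma> j) powr \<theta>"
  have "\<theta> * a > 0"
    using r2 r unfolding \<theta>(3) by (simp add: field_simps)
  then have \<theta>a: "\<theta> > 0" "a > 0"
    using \<theta>(1,2) by (auto simp: zero_less_mult_iff)
  define s' where "s' = s powr (1 / \<theta>)"
  have s': "s' > 0" "s' powr \<theta> = s"
    using s \<theta>a by (simp_all add: s'_def powr_powr)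
  have "s' < cmod (\<sigma> j)" if "j \<in> G" for j
  proof -
    have "\<not> cmod (\<sigma> j) \<le> s'"
      using powr_mono2[of \<theta> "cmod (\<sigma> j)" s'] G(2)[OF that] \<theta> s' by auto
    then show ?thesis
      by simp
  qed
  then have "(\<Sum>j\<in>G. (Linf_norm (u j))\<^sup>2) \<le> ennreal ((B / s') powr (1 / a))"
    using weak_type_tail_bound[OF s'(1) \<theta>a(2) _ weak[OF s'(1)] G(1)] BN by auto
  also have "(B / s') powr (1 / a) = (B powr \<theta> / s) powr (1 / (\<theta> * a))"
    unfolding s'(2)[symmetric] powr_divide[symmetric] powr_powr using \<theta>a by simp
  also have "1 / (\<theta> * a) = 2 * r / (2 - r)"
    unfolding \<theta>(3) using r r2 by (simp add: field_simps)
  finally show "(\<Sum>j\<in>G. (Linf_norm (u j))\<^sup>2) \<le> ennreal ((B powr \<theta> / s) powr (2 * r / (2 - r)))" .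
next
  fix j
  assume "r = 2"
  then have "\<theta> = 0 \<or> a = 0"
    using \<theta> by simp
  then show "cmod (\<sigma> j) powr \<theta> \<le> B powr \<theta>"
  proof
    assume "a = 0"
    have "cmod (\<sigma> j) \<le> B"
      by (rule symbol_le_of_weak_type_0[where c = "\<lambda>j. (Linf_norm (u j))\<^sup>2"])
        (use BN weak \<open>a = 0\<close> less_imp_neq[OF Linf_norm_orthonormal_pos[OF u]]
          in \<open>auto simp: zero_less_iff_neq_zero\<close>)
    then show ?thesis
      using \<theta> by (intro powr_mono2) auto
  qed (use BN in auto)
qed (use BN in auto)

text \<open>By Parseval's identity the pairing is \<open>\<Sum> \<sigma>\<^sub>j a\<^sub>j b\<^sub>j\<close> with the coefficients of \<open>f\<close> and the
  conjugate coefficients of \<open>g\<close>. Writing \<open>\<bar>\<sigma>\<bar> = \<bar>\<sigma>\<bar>\<^sup>\<theta> \<bar>\<sigma>\<bar>\<^sup>1\<^sup>-\<^sup>\<theta>\<close> and applying the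
  Cauchy--Schwarz inequality separates \<open>f\<close> from \<open>g\<close>. In the application \<open>r\<close> is the dual exponent
  of \<open>q\<close>, and \<open>1/p + 1/r - 1 = 1/p - 1/q\<close>.\<close>

lemma multiplier_pairing_le:
  assumes u: "orthonormal_basis u" and f: "f \<in> Lp_space 2" and g: "g \<in> Lp_space 2"
    and h: "h \<in> Lp_space 2" and hf: "\<And>j. L2_inner h (u j) = \<sigma> j * L2_inner f (u j)"
    and r: "1 < p" "p \<le> 2" "1 < r" "r \<le> 2"
    and BNM: "B > 0" "N > 0" "M > 0"
    and fp: "(\<integral>\<^sup>+x. ennreal (cmod (f x) powr p) \<partial>lebesgue) \<le> ennreal (N powr p)"
    and gr: "(\<integral>\<^sup>+x. ennreal (cmod (g x) powr r) \<partial>lebesgue) \<le> ennreal (M powr r)"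
    and weak: "\<And>s. s > 0 \<Longrightarrow>
      ennreal s * ennpow (\<Sum>\<^sub>\<infinity>j\<in>{j. cmod (\<sigma> j) > s}. (Linf_norm (u j))\<^sup>2) (1 / p + 1 / r - 1)
        \<le> ennreal B"
  shows "cmod (L2_inner h g) \<le> sqrt (Paley_const p * Paley_const r) * B * N * M"
proof (rule Lim_bounded)
  show "(\<lambda>n. cmod (\<Sum>j<n. L2_inner h (u j) * cnj (L2_inner g (u j)))) \<longlonglongrightarrow> cmod (L2_inner h g)"
    by (intro tendsto_norm Parseval_identity u h g)
  define a where "a = 1 / p + 1 / r - 1"
  \<comment> \<open>This share of the exponent goes to \<open>f\<close>. For \<open>p = r = 2\<close> the quotient is \<open>0 / 0 = 0\<close>, and the
    whole symbol goes to \<open>g\<close>.\<close>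
  define \<theta> where "\<theta> = (1 / p - 1 / 2) / a"
  define \<eta> where "\<eta> = 1 - \<theta>"
  have pr: "1 / p - 1 / 2 \<ge> 0" "1 / r - 1 / 2 \<ge> 0"
    using r by (simp_all add: field_simps)
  have a: "a = (1 / p - 1 / 2) + (1 / r - 1 / 2)"
    by (simp add: a_def)
  have \<theta>: "\<theta> \<ge> 0" "a \<ge> 0" "\<eta> \<ge> 0" "\<theta> * a = 1 / p - 1 / 2" "\<eta> * a = 1 / r - 1 / 2"
  proof -
    show "\<theta> \<ge> 0" "a \<ge> 0"
      using pr by (simp_all add: \<theta>_def a)
    show \<theta>a: "\<theta> * a = 1 / p - 1 / 2"
    proof (cases "a = 0")
      case True
      then have "1 / p - 1 / 2 = 0"
        using pr a by linarith
      then show ?thesis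
        by (simp only: True mult_zero_right)
    qed (simp add: \<theta>_def)
    then show \<eta>a: "\<eta> * a = 1 / r - 1 / 2"
      by (simp add: \<eta>_def left_diff_distrib a)
    show "\<eta> \<ge> 0"
    proof (cases "a = 0")
      case False
      then have "a > 0"
        using \<open>a \<ge> 0\<close> by simp
      then show ?thesis
        using \<eta>a pr(2) by (metis zero_le_mult_iff not_le)
    qed (simp add: \<eta>_def \<theta>_def)
  qed
  have "cmod (\<Sum>j<n. L2_inner h (u j) * cnj (L2_inner g (u j)))
      \<le> sqrt (Paley_const p * Paley_const r) * B * N * M" for n
  proof -
    define x where "x j = cmod (\<sigma> j) powr \<theta> * cmod (L2_inner f (u j))" for j
    define y where "y j = cmod (\<sigma> j) powr \<eta> * cmod (L2_inner g (u j))" for j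
    have "cmod (\<Sum>j<n. L2_inner h (u j) * cnj (L2_inner g (u j))) \<le> (\<Sum>j<n. x j * y j)"
    proof (rule sum_norm_le)
      fix j
      have "cmod (\<sigma> j) = cmod (\<sigma> j) powr \<theta> * cmod (\<sigma> j) powr \<eta>"
        by (simp add: \<eta>_def flip: powr_add)
      then show "norm (L2_inner h (u j) * cnj (L2_inner g (u j))) \<le> x j * y j"
        by (simp add: hf norm_mult x_def y_def mult_ac)
    qed
    also have "\<dots> \<le> sqrt ((\<Sum>j<n. (x j)\<^sup>2) * (\<Sum>j<n. (y j)\<^sup>2))"
      by (intro real_le_rsqrt Cauchy_Schwarz_ineq_sum)
    also have "\<dots> \<le> sqrt ((Paley_const p * (B powr \<theta> * N)\<^sup>2) * (Paley_const r * (B powr \<eta> * M)\<^sup>2))"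
      unfolding x_def y_def
      by (intro real_sqrt_le_mono mult_mono
          power_of_symbol_weighted_Bessel[OF u r(1,2) BNM(1,2) f fp \<theta>(1,2,4)]
          power_of_symbol_weighted_Bessel[OF u r(3,4) BNM(1,3) g gr \<theta>(3,2,5)])
        (use weak Paley_const_pos[OF r(1,2)] in \<open>auto simp: a_def intro: sum_nonneg\<close>)
    also have "(Paley_const p * (B powr \<theta> * N)\<^sup>2) * (Paley_const r * (B powr \<eta> * M)\<^sup>2)
        = (Paley_const p * Paley_const r) * (B powr \<theta> * B powr \<eta> * N * M)\<^sup>2"
      by (simp add: power_mult_distrib mult_ac)
    also have "B powr \<theta> * B powr \<eta> = B"
      using BNM by (simp add: \<eta>_def flip: powr_add)
    also have "sqrt ((Paley_const p * Paley_const r) * (B * N * M)\<^sup>2)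
        = sqrt (Paley_const p * Paley_const r) * B * N * M"
      using BNM by (simp add: real_sqrt_mult)
    finally show ?thesis .
  qed
  then show "\<forall>n\<ge>0. cmod (\<Sum>j<n. L2_inner h (u j) * cnj (L2_inner g (u j)))
      \<le> sqrt (Paley_const p * Paley_const r) * B * N * M"
    by simp
qed

text \<open>Duality, tested with \<open>g = h \<bar>h\<bar>\<^sup>q\<^sup>-\<^sup>2\<close> cut off at the height \<open>R\<close>. The cut-off puts \<open>g\<close> into \<open>L\<^sup>2\<close> and
  makes the integral \<open>X\<close> of the cut-off \<open>\<bar>h\<bar>\<^sup>q\<close> finite, so that the inequality
  \<open>X \<le> L X powr (1 - 1 / q)\<close> can be divided; monotone convergence then removes the cut-off.\<close>

lemma Lq_bound_of_pairing_bound: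
  assumes h: "h \<in> Lp_space 2" and q: "q \<ge> 2" and "L > 0"
    and pairing: "\<And>g M. g \<in> Lp_space 2 \<Longrightarrow> M > 0 \<Longrightarrow>
      (\<integral>\<^sup>+x. ennreal (cmod (g x) powr (q / (q - 1))) \<partial>lebesgue) \<le> ennreal (M powr (q / (q - 1))) \<Longrightarrow>
      cmod (L2_inner h g) \<le> L * M"
  shows "Lp_norm q h \<le> ennreal L"
proof -
  have hm [measurable]: "h \<in> borel_measurable lebesgue"
    by (rule measurable_Lp_space[OF h])
  define H where "H R x = cmod (cut_below R h x) powr q" for R x
  have [measurable]: "H R \<in> borel_measurable lebesgue" for R
    unfolding H_def by measurable
  have bound: "(\<integral>\<^sup>+x. ennreal (H R x) \<partial>lebesgue) \<le> ennreal (L powr q)" if "R \<ge> 0" for R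
  proof -
    have H_split: "H R x = (cmod (cut_below R h x))\<^sup>2 * cmod (cut_below R h x) powr (q - 2)" for x
      using powr_add[of "cmod (cut_below R h x)" 2 "q - 2"] by (simp add: H_def)
    have cut_le: "cmod (cut_below R h x) \<le> R" for x
      using that by (simp add: cut_below_def)
    have H_le: "H R x \<le> R powr (q - 2) * (cmod (h x))\<^sup>2" for x
      unfolding H_split mult.commute[of "_\<^sup>2"]
      by (intro mult_mono powr_mono2 power_mono) (use q cut_le in \<open>auto simp: cut_below_def\<close>)
    have H_int: "integrable lebesgue (H R)"
    proof (rule Bochner_Integration.integrable_bound)
      show "integrable lebesgue (\<lambda>x. R powr (q - 2) * (cmod (h x))\<^sup>2)"
        using h by (simp add: Lp_space_2_integrable_iff)
      show "AE x in lebesgue. norm (H R x) \<le> norm (R powr (q - 2) * (cmod (h x))\<^sup>2)"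
        using H_le by (simp add: H_def abs_mult)
    qed simp
    define X where "X = (\<integral>x. H R x \<partial>lebesgue)"
    have X: "(\<integral>\<^sup>+x. ennreal (H R x) \<partial>lebesgue) = ennreal X"
      unfolding X_def by (intro nn_integral_eq_integral H_int) (simp add: H_def)
    have "X \<ge> 0"
      unfolding X_def by (simp add: H_def)
    show ?thesis
    proof (cases "X = 0")
      case False
      with \<open>X \<ge> 0\<close> have "X > 0"
        by simp
      define M where "M = X powr ((q - 1) / q)"
      define g where "g x = of_real (cmod (cut_below R h x) powr (q - 2)) * cut_below R h x" for x
      have "g \<in> Lp_space 2"
      proof (rule Lp_space_2_dominated[OF h, of _ "R powr (q - 2)"])
        show "g \<in> borel_measurable lebesgue"
          unfolding g_def by measurable
        show "cmod (g x) \<le> R powr (q - 2) * cmod (h x)" for x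
          unfolding g_def norm_mult
          by (intro mult_mono) (use q powr_mono2[OF _ _ cut_le] in \<open>auto simp: cut_below_def\<close>)
      qed
      moreover have "M > 0"
        using \<open>X > 0\<close> by (simp add: M_def)
      moreover have "cmod (g x) powr (q / (q - 1)) = H R x" for x
      proof (cases "cut_below R h x = 0")
        case False
        have "cmod (g x) = cmod (cut_below R h x) powr (q - 1)"
          using False by (simp add: g_def norm_mult powr_mult_base mult.commute)
        then show ?thesis
          using q by (simp add: H_def powr_powr)
      qed (simp add: g_def H_def)
      moreover have "M powr (q / (q - 1)) = X"
        using q \<open>X > 0\<close> by (simp add: M_def powr_powr)
      ultimately have "cmod (L2_inner h g) \<le> L * M"
        using X by (intro pairing) simp_all
      also have "L2_inner h g = of_real X"
      proof -
        have "h x * cnj (g x) = of_real (H R x)" for x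
        proof -
          have "h x * cnj (g x) = of_real (cmod (cut_below R h x) powr (q - 2))
              * (cut_below R h x * cnj (cut_below R h x))"
            by (simp add: g_def cut_below_def)
          also have "\<dots> = of_real (H R x)"
            unfolding complex_norm_square[symmetric] H_split by (simp add: mult.commute)
          finally show ?thesis .
        qed
        then show ?thesis
          by (simp add: L2_inner_def X_def)
      qed
      finally have "X \<le> L * X powr ((q - 1) / q)"
        using \<open>X > 0\<close> by (simp add: M_def)
      moreover have "X = X powr (1 / q) * X powr ((q - 1) / q)"
      proof -
        have "1 / q + (q - 1) / q = 1"
          using q by (simp add: field_simps)
        then have "X powr (1 / q + (q - 1) / q) = X"
          using \<open>X > 0\<close> by (simp only: powr_one_gt_zero_iff less_imp_le)
        then show ?thesis
          by (simp only: powr_add)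
      qed
      ultimately have "X powr (1 / q) * X powr ((q - 1) / q) \<le> L * X powr ((q - 1) / q)"
        by simp
      then have "X powr (1 / q) \<le> L"
        using \<open>X > 0\<close> by simp
      then have "(X powr (1 / q)) powr q \<le> L powr q"
        using q by (intro powr_mono2) auto
      then show ?thesis
        using q \<open>X > 0\<close> X by (simp add: powr_powr)
    qed (simp add: X)
  qed
  have "incseq (\<lambda>n x. ennreal (H (real n) x))"
    by (auto simp: incseq_def le_fun_def H_def cut_below_def)
  then have "(\<integral>\<^sup>+x. (SUP n. ennreal (H (real n) x)) \<partial>lebesgue)
      = (SUP n. \<integral>\<^sup>+x. ennreal (H (real n) x) \<partial>lebesgue)"
    by (intro nn_integral_monotone_convergence_SUP) measurable
  also have "\<dots> \<le> ennreal (L powr q)"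
    by (intro SUP_least bound) simp
  finally have sup: "(\<integral>\<^sup>+x. (SUP n. ennreal (H (real n) x)) \<partial>lebesgue) \<le> ennreal (L powr q)" .
  have "(\<integral>\<^sup>+x. ennreal (cmod (h x) powr q) \<partial>lebesgue)
      \<le> (\<integral>\<^sup>+x. (SUP n. ennreal (H (real n) x)) \<partial>lebesgue)"
  proof (rule nn_integral_mono)
    fix x
    obtain n where "cmod (h x) \<le> real n"
      using real_arch_simple by blast
    then have "ennreal (cmod (h x) powr q) = ennreal (H (real n) x)"
      by (simp add: H_def cut_below_def)
    also have "\<dots> \<le> (SUP n. ennreal (H (real n) x))"
      by (rule SUP_upper) simp
    finally show "ennreal (cmod (h x) powr q) \<le> (SUP n. ennreal (H (real n) x))" .
  qed
  with sup have "(\<integral>\<^sup>+x. ennreal (cmod (h x) powr q) \<partial>lebesgue) \<le> ennreal (L powr q)"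
    by (rule order_trans[rotated])
  then show ?thesis
    using q \<open>L > 0\<close> by (simp add: Lp_norm_le_iff)
qed

lemma multiplier_Lp_Lq_bound:
  assumes u: "orthonormal_basis u" and f: "f \<in> Lp_space 2" and h: "h \<in> Lp_space 2"
    and hf: "\<And>j. L2_inner h (u j) = \<sigma> j * L2_inner f (u j)"
    and pq: "1 < p" "p \<le> 2" "2 \<le> q"
    and BN: "B > 0" "N > 0" and fp: "Lp_norm p f \<le> ennreal N"
    and weak: "\<And>s. s > 0 \<Longrightarrow>
      ennreal s * ennpow (\<Sum>\<^sub>\<infinity>j\<in>{j. cmod (\<sigma> j) > s}. (Linf_norm (u j))\<^sup>2) (1 / p - 1 / q)
        \<le> ennreal B"
  shows "Lp_norm q h \<le> ennreal (sqrt (Paley_const p * Paley_const (q / (q - 1))) * B * N)"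
proof (rule Lq_bound_of_pairing_bound[OF h pq(3)])
  have r: "1 < q / (q - 1)" "q / (q - 1) \<le> 2"
    using pq by (simp_all add: field_simps)
  show "0 < sqrt (Paley_const p * Paley_const (q / (q - 1))) * B * N"
    using BN Paley_const_pos[OF pq(1,2)] Paley_const_pos[OF r] by simp
  have e: "1 / p + 1 / (q / (q - 1)) - 1 = 1 / p - 1 / q"
    using pq by (simp add: field_simps)
  fix g :: "'a \<Rightarrow> complex" and M :: real
  assume "g \<in> Lp_space 2" "M > 0"
    "(\<integral>\<^sup>+x. ennreal (cmod (g x) powr (q / (q - 1))) \<partial>lebesgue) \<le> ennreal (M powr (q / (q - 1)))"
  then show "cmod (L2_inner h g)
      \<le> sqrt (Paley_const p * Paley_const (q / (q - 1))) * B * N * M"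
    using pq BN fp weak
    by (intro multiplier_pairing_le[OF u f _ h hf pq(1,2) r, unfolded e])
      (simp_all add: Lp_norm_le_iff)
qed

text \<open>Strict upper bounds are positive and can be divided by, even if the quantities that they bound
  vanish.\<close>

lemma ennreal_le_mult_of_strict_upper_bounds:
  assumes "\<And>B N. B > b \<Longrightarrow> N > n \<Longrightarrow> x \<le> ennreal (c * B * N)"
    and "b \<ge> 0" "n \<ge> 0" "c \<ge> 0"
  shows "x \<le> ennreal c * ennreal b * ennreal n"
proof -
  have "(\<lambda>i. ennreal (c * (b + 1 / Suc i) * (n + 1 / Suc i))) \<longlonglongrightarrow> ennreal (c * (b + 0) * (n + 0))"
    by (intro tendsto_ennrealI tendsto_intros lim_const_over_n[of 1] LIMSEQ_Suc[of "\<lambda>i. 1 / real i"])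
  moreover have "x \<le> ennreal (c * (b + 1 / Suc i) * (n + 1 / Suc i))" for i
    by (rule assms(1)) auto
  ultimately have "x \<le> ennreal (c * (b + 0) * (n + 0))"
    by (intro LIMSEQ_le_const) auto
  then show ?thesis
    using assms by (simp add: ennreal_mult)
qed

theorem theorem1p2:
  fixes k l :: nat and p q :: real
    and T :: "(real ^ 'n::finite) L2_operator"
    and u :: "nat \<Rightarrow> real ^ 'n \<Rightarrow> complex" and ev :: "nat \<Rightarrow> real"
  assumes "k \<ge> 1" and "l \<ge> 1"
    and "self_adjoint_extension T (anharmonic_op k l)"
    and "eigenbasis T u ev"
    and "1 < p" and "p \<le> 2" and "2 \<le> q"
  shows "\<exists>C::real > 0. \<forall>m \<sigma>. A_multiplier u ev m \<sigma> \<longrightarrow>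
    multiplier_norm u ev p q m \<le> ennreal C *
      (SUP s\<in>{0::real<..}. ennreal s *
        ennpow (\<Sum>\<^sub>\<infinity>j\<in>{j. cmod (\<sigma> j) > s}. (Linf_norm (u j))\<^sup>2) (1 / p - 1 / q))"
proof -
  have u: "orthonormal_basis u"
    using assms by (simp add: eigenbasis_def)
  have r: "1 < q / (q - 1)" "q / (q - 1) \<le> 2"
    using assms by (simp_all add: field_simps)
  define C where "C = sqrt (Paley_const p * Paley_const (q / (q - 1)))"
  have C: "C > 0"
    using Paley_const_pos[OF \<open>1 < p\<close> \<open>p \<le> 2\<close>] Paley_const_pos[OF r] by (simp add: C_def)
  have "multiplier_norm u ev p q m \<le> ennreal C *
      (SUP s\<in>{0::real<..}. ennreal s *
        ennpow (\<Sum>\<^sub>\<infinity>j\<in>{j. cmod (\<sigma> j) > s}. (Linf_norm (u j))\<^sup>2) (1 / p - 1 / q))"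
    (is "_ \<le> ennreal C * ?S") if m: "A_multiplier u ev m \<sigma>" for m \<sigma>
  proof (cases ?S)
    case top
    then show ?thesis
      unfolding top using C by (simp add: ennreal_mult_top)
  next
    case (real b)
    have "Lp_norm q (m f) \<le> ennreal C * ?S * Lp_norm p f" if f: "f \<in> CA_infty u ev \<inter> Lp_space p" for f
    proof -
      have f2: "f \<in> Lp_space 2"
        using f by (auto simp: CA_infty_def dom_power_def)
      have h2: "m f \<in> Lp_space 2"
        using m f by (auto simp: A_multiplier_def)
      have hf: "L2_inner (m f) (u j) = \<sigma> j * L2_inner f (u j)" for j
        using m f by (auto simp: A_multiplier_def A_fourier_def L2_inner_def)
      have "Lp_norm p f < \<infinity>"
        using f by (simp add: Lp_space_def)
      then obtain n where n: "n \<ge> 0" "Lp_norm p f = ennreal n"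
        by (cases "Lp_norm p f") auto
      have "Lp_norm q (m f) \<le> ennreal (C * B * N)" if "B > b" "N > n" for B N
        unfolding C_def
      proof (rule multiplier_Lp_Lq_bound[OF u f2 h2 hf assms(5-7)])
        show "Lp_norm p f \<le> ennreal N"
          using n that by (simp add: ennreal_leI)
        fix s :: real
        assume "s > 0"
        then have "ennreal s * ennpow (\<Sum>\<^sub>\<infinity>j\<in>{j. cmod (\<sigma> j) > s}. (Linf_norm (u j))\<^sup>2) (1 / p - 1 / q)
            \<le> ?S"
          by (intro SUP_upper) auto
        also have "\<dots> \<le> ennreal B"
          using real that by (simp add: ennreal_leI)
        finally show "ennreal s * ennpow (\<Sum>\<^sub>\<infinity>j\<in>{j. cmod (\<sigma> j) > s}. (Linf_norm (u j))\<^sup>2) (1 / p - 1 / q)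
            \<le> ennreal B" .
      qed (use real n that in auto)
      then show ?thesis
        unfolding real(2) n(2) using C real n
        by (intro ennreal_le_mult_of_strict_upper_bounds) auto
    qed
    then show ?thesis
      unfolding multiplier_norm_def by (intro Inf_lower) auto
  qed
  with C show ?thesis
    by blast
qed

end
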